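(* Let $n_1,n_2,\ldots$ be a lacunary sequence of positive integers, and let $\psi:\mathbb{N}\to[0,1]$. Then $$\dim_{\mathrm{F}}\left([0,1]^2\setminus\mathcal{R}(\psi)\right)=0.$$
   Context: For $x\in\mathbb{R}$, $\|x\|$ denotes the distance from $x$ to the nearest integer. A sequence $(n_t)$ of positive integers is lacunary if there is $c>1$ with $n_{t+1}\ge c\, n_t$ for all $t\ge1$. For $(\alpha,\gamma)\in\mathbb{R}^2$ and $N\in\mathbb{N}$ put $$\mathcal{N}(\alpha,\gamma,\psi,N)=\#\{t\le N : \|n_t\alpha-\gamma\|\le\psi(n_t)\},\qquad \Psi(N)=\sum_{t\le N}\psi(n_t).$$ $\mathcal{R}(\psi)$ is the set of $(\alpha,\gamma)\in\mathbb{R}^2$ for which $$\mathcal{N}(\alpha,\gamma,\psi,N)=2\Psi(N)+O\left(\Psi(N)^{2/3}\left(\log(2+\Psi(N))\right)^3\right),$$ where the implied constant may depend on $(\alpha,\gamma)$, but not on $N$. For a Borel set $\mathcal{A}\subseteq\mathbb{R}^2$, $\mathcal{M}(\mathcal{A})$ is the set of Borel probability measures supported on a compact subset of $\mathcal{A}$, and the Fourier dimension $\dim_{\mathrm{F}}(\mathcal{A})$ is the supremum of those $s\le2$ for which there exists $\mu\in\mathcal{M}(\mathcal{A})$ with $\widehat{\mu}(\boldsymbol{\xi})\ll_s(1+|\boldsymbol{\xi}|)^{-s/2}$ for $\boldsymbol{\xi}\in\mathbb{R}^2$, where $\widehat{\mu}(\boldsymbol{\xi})=\int e^{-2\pi i\boldsymbol{\xi}\cdot\mathbf{x}}\,d\mu(\mathbf{x})$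 and $f\ll_s g$ means $|f|\le C|g|$ for some constant $C>0$ depending on $s$.
   Formalization: The formal theorem additionally assumes ψ(n_t) ≤ 1/2 for all t ≥ 1; with ψ: ℕ → [0,1] alone the claim fails, e.g. ψ ≡ 1 gives count N against main term 2N, so R(ψ) is empty and the dimension is 2. *)

theory Defs
  imports "HOL-Probability.Probability"
begin

definition dist_nearest_int :: "real \<Rightarrow> real" where
  "dist_nearest_int x = \<bar>x - of_int (round x)\<bar>"

text \<open>Sequences are indexed from 1; the value at index 0 is never used.\<close>

definition lacunary :: "(nat \<Rightarrow> nat) \<Rightarrow> bool" where
  "lacunary n \<longleftrightarrow> (\<exists>c::real. c > 1 \<and> (\<forall>t\<ge>1. real (n (t + 1)) \<ge> c * real (n t)))"

definition hit_count :: "(nat \<Rightarrow> nat) \<Rightarrow> (nat \<Rightarrow> real) \<Rightarrow> real \<Rightarrow> real \<Rightarrow> nat \<Rightarrow> nat" where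
  "hit_count n \<psi> \<alpha> \<gamma> N =
     card {t \<in> {1..N}. dist_nearest_int (real (n t) * \<alpha> - \<gamma>) \<le> \<psi> (n t)}"

definition psi_sum :: "(nat \<Rightarrow> nat) \<Rightarrow> (nat \<Rightarrow> real) \<Rightarrow> nat \<Rightarrow> real" where
  "psi_sum n \<psi> N = (\<Sum>t=1..N. \<psi> (n t))"

text \<open>The error bound is required for every \<open>N\<close>, not only for large \<open>N\<close>; since
  \<open>0 powr (2/3) = 0\<close>, there are no hits as long as the sum of the radii vanishes.\<close>

definition regular_set :: "(nat \<Rightarrow> nat) \<Rightarrow> (nat \<Rightarrow> real) \<Rightarrow> (real \<times> real) set" where
  "regular_set n \<psi> = {(\<alpha>, \<gamma>). \<exists>C>0. \<forall>N.
     \<bar>real (hit_count n \<psi> \<alpha> \<gamma> N) - 2 * psi_sum n \<psi> N\<bar>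
       \<le> C * (psi_sum n \<psi> N powr (2/3) * (ln (2 + psi_sum n \<psi> N)) ^ 3)}"

definition compactly_supported_probs :: "(real \<times> real) set \<Rightarrow> (real \<times> real) measure set" where
  "compactly_supported_probs A =
     {\<mu>. sets \<mu> = sets borel \<and> prob_space \<mu> \<and>
         (\<exists>K. compact K \<and> K \<subseteq> A \<and> emeasure \<mu> (- K) = 0)}"

definition fourier_transform :: "(real \<times> real) measure \<Rightarrow> real \<times> real \<Rightarrow> complex" where
  "fourier_transform \<mu> \<xi> =
     (\<integral>x. exp (- 2 * complex_of_real pi * \<i> * complex_of_real (\<xi> \<bullet> x)) \<partial>\<mu>)"

definition fourier_decay :: "(real \<times> real) measure \<Rightarrow> real \<Rightarrow> bool" where
  "fourier_decay \<mu> s \<longleftrightarrow>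
     (\<exists>C>0. \<forall>\<xi>. norm (fourier_transform \<mu> \<xi>) \<le> C * (1 + norm \<xi>) powr (- s / 2))"

text \<open>For nonempty \<open>A\<close> the exponent 0 is always admissible (take a point mass), so
  inserting it only fixes the convention that the empty set has Fourier dimension 0;
  the supremum of the empty set is unspecified on the reals.\<close>

definition fourier_dim :: "(real \<times> real) set \<Rightarrow> real" where
  "fourier_dim A =
     Sup (insert 0 {s. s \<le> 2 \<and> (\<exists>\<mu>\<in>compactly_supported_probs A. fourier_decay \<mu> s)})"

end

theory Submission
  imports Defs
begin

text \<open>
  A measure \<open>\<mu>\<close> on the plane whose Fourier transform decays like a power \<open>|\<xi>|^(-\<delta>)\<close>,
  \<open>\<delta> > 0\<close>, gives full mass to the regular set. A compact set avoiding the regular set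
  therefore carries no such measure, which is the assertion.

  Put \<open>y\<^sub>t = n\<^sub>t \<alpha> - \<gamma>\<close> and \<open>p\<^sub>t = \<psi>(n\<^sub>t)\<close>, and let \<open>X\<^sub>t\<close> be the indicator of \<open>\<parallel>y\<^sub>t\<parallel> \<le> p\<^sub>t\<close>
  minus its Lebesgue mean \<open>2 p\<^sub>t\<close>. Formally \<open>X\<^sub>t = \<Sum> a\<^sub>k cos (2\<pi>k y\<^sub>t)\<close> over \<open>k \<ge> 1\<close>, with
  \<open>|a\<^sub>k| \<le> min (4 p\<^sub>t) (1/k)\<close>. The series is Abel summed: its Abel means are differences
  of values of \<open>Im (Ln (1 - r e(x)))\<close>, where \<open>e(x) = cis (2\<pi>x)\<close>; they are bounded, and they converge to \<open>X\<^sub>t\<close> away from the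
  endpoints of the interval, which correspond to \<open>\<mu>\<close>-null lines. Hence moments of
  the \<open>X\<^sub>t\<close> are controlled by sums of Fourier coefficients of \<open>\<mu>\<close>, and power decay turns the
  coefficient bound \<open>1/k\<close> into a summable one.

  For the mean this gives \<open>E X\<^sub>t = O(n\<^sub>t^(-\<delta>/3))\<close>. For \<open>t < u\<close> the product \<open>X\<^sub>t X\<^sub>u\<close> involves the
  frequencies \<open>k (n\<^sub>t, -1) \<plusminus> l (n\<^sub>u, -1)\<close>. For \<open>n \<noteq> n'\<close> the vectors \<open>(n, -1)\<close> and \<open>(n', -1)\<close> are linearly
  independent, and by lacunarity quantitatively so: the
  norm of each frequency is at least a constant times \<open>k\<close> and times \<open>l n\<^sub>u / n\<^sub>t\<close>. For the plus
  sign, and for the minus sign if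
  \<open>|k n\<^sub>t - l n\<^sub>u| \<ge> n\<^sub>t/2\<close>, the norm also dominates \<open>n\<^sub>t\<close>, and the geometric mean of the three bounds
  contributes \<open>O(n\<^sub>u^(-\<delta>/3))\<close> in total. In the remaining case \<open>k\<close> is determined by \<open>l\<close>, so that
  the bound \<open>|a\<^sub>k| \<le> 4 p\<^sub>t\<close> can be afforded, and the contribution is \<open>O(p\<^sub>t (n\<^sub>t/n\<^sub>u)^(\<delta>/3))\<close>.
  Keeping this factor \<open>p\<^sub>t\<close> is the crux: summing over \<open>t < u \<le> N\<close> yields
  \<open>E (\<Sum>\<^sub>t\<^sub>\<le>\<^sub>N X\<^sub>t)\<^sup>2 = O(\<Psi>(N) + 1)\<close>, in terms of \<open>\<Psi>\<close> alone, however slowly it grows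
  (\<open>abs_cosine_pair_le\<close>, \<open>abs_expectation_pair_hit_deviation_le\<close>, \<open>second_moment_le\<close>).

  The rest is Chebyshev and Borel--Cantelli. If \<open>\<Psi>\<close> is unbounded, let \<open>T j\<close> be the
  first index with \<open>\<Psi>(T j) \<ge> j\<^sup>3\<close>. The deviation at \<open>T j\<close> exceeds \<open>j\<^sup>2 ln (j + 1)\<close> with probability
  \<open>O(1/(j (ln (j + 1))\<^sup>2))\<close>, which is summable, and between \<open>T j\<close> and \<open>T (j + 1)\<close> both the number of hits and
  \<open>2\<Psi>\<close> are monotone while \<open>\<Psi>\<close> grows only by \<open>O(j\<^sup>2)\<close>, that is, by \<open>O(\<Psi>^(2/3))\<close>. If \<open>\<Psi>\<close> is
  bounded, almost every point has finitely many hits.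
\<close>

section \<open>Abel means of the Fourier series of an interval\<close>

text \<open>The cosine coefficients of the 1-periodic indicator of \<open>[-p, p]\<close> (for \<open>0 \<le> p \<le> 1/2\<close>); the
  coefficient at 0 vanishes by division by 0, which is what the centred function needs.\<close>

definition hit_coeff :: "real \<Rightarrow> nat \<Rightarrow> real" where
  "hit_coeff p k = 2 * sin (2 * pi * real k * p) / (pi * real k)"

definition hit_deviation :: "real \<Rightarrow> real \<Rightarrow> real" where
  "hit_deviation p y = of_bool (dist_nearest_int y \<le> p) - 2 * p"

text \<open>The Abel means of the Fourier series of \<open>hit_deviation p\<close>. As \<open>r\<close> tends to 1,
  \<open>Im (Ln (1 - r e(x))) / \<pi>\<close> becomes the sawtooth \<open>frac x - 1/2\<close> at every non-integer \<open>x\<close>, where \<open>e(x) = cis (2\<pi>x)\<close>, and the centred indicator of an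
  interval is the difference of two shifted sawtooth functions.\<close>

definition abel_deviation :: "real \<Rightarrow> real \<Rightarrow> real \<Rightarrow> real" where
  "abel_deviation r p y =
     (Im (Ln (1 - of_real r * cis (2 * pi * (y - p)))) - Im (Ln (1 - of_real r * cis (2 * pi * (y + p))))) / pi"

lemma hit_coeff_zero [simp]: "hit_coeff p 0 = 0"
  by (simp add: hit_coeff_def)

lemma abs_hit_coeff_le_inverse:
  assumes "k \<ge> 1"
  shows "\<bar>hit_coeff p k\<bar> \<le> 1 / real k"
proof -
  have "2 * \<bar>sin (2 * pi * real k * p)\<bar> \<le> pi"
    using pi_ge_two abs_sin_le_one[of "2 * pi * real k * p"] by linarith
  then show ?thesis
    using assms unfolding hit_coeff_def by (simp add: abs_mult field_simps)
qed

lemma abs_hit_coeff_le_radius: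
  assumes "k \<ge> 1" "p \<ge> 0"
  shows "\<bar>hit_coeff p k\<bar> \<le> 4 * p"
proof -
  have "\<bar>sin (2 * pi * real k * p)\<bar> \<le> 2 * pi * real k * p"
    using abs_sin_x_le_abs_x[of "2 * pi * real k * p"] assms by (simp add: abs_mult)
  then show ?thesis
    using assms unfolding hit_coeff_def by (simp add: abs_mult field_simps)
qed

lemma abs_hit_coeff_le_1: "\<bar>hit_coeff p k\<bar> \<le> 1"
proof (cases "k = 0")
  case False
  then have "1 / real k \<le> 1" by simp
  then show ?thesis using abs_hit_coeff_le_inverse[of k p] False by linarith
qed simp

lemma sine_series_sums:
  assumes "0 \<le> r" "r < 1"
  shows "(\<lambda>k. r ^ k * sin (real k * x) / real k) sums (- Im (Ln (1 - of_real r * cis x)))"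
proof -
  have "cmod (- (of_real r * cis x)) < 1"
    using assms by (simp add: norm_mult)
  from Ln_series'[OF this]
  have "(\<lambda>n. Im (- ((of_real r * cis x) ^ n / of_nat n))) sums Im (Ln (1 - of_real r * cis x))"
    by (intro sums_Im) simp
  moreover have "Im (- ((of_real r * cis x) ^ n / of_nat n)) = - (r ^ n * sin (real n * x) / real n)" for n
  proof -
    have "(of_real r * cis x) ^ n / of_nat n = of_real (r ^ n / real n) * cis (real n * x)"
      by (simp add: power_mult_distrib Complex.DeMoivre)
    then have "Im (- ((of_real r * cis x) ^ n / of_nat n)) = - Im (of_real (r ^ n / real n) * cis (real n * x))"
      by (simp only: uminus_complex.sel)
    then show ?thesis by simp
  qed
  ultimately have "(\<lambda>n. - (r ^ n * sin (real n * x) / real n)) sums Im (Ln (1 - of_real r * cis x))"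
    by (simp only:)
  from sums_minus[OF this] show ?thesis by simp
qed

lemma abel_deviation_sums:
  assumes "0 \<le> r" "r < 1"
  shows "(\<lambda>k. r ^ k * hit_coeff p k * cos (2 * pi * real k * y)) sums abel_deviation r p y"
proof -
  have "(\<lambda>k. (r ^ k * sin (real k * (2 * pi * (y + p))) / real k
            - r ^ k * sin (real k * (2 * pi * (y - p))) / real k) / pi) sums abel_deviation r p y"
    using sums_divide[OF sums_diff[OF sine_series_sums[OF assms] sine_series_sums[OF assms]], of "2 * pi * (y + p)" "2 * pi * (y - p)" pi]
    by (simp add: abel_deviation_def)
  moreover have "(r ^ k * sin (real k * (2 * pi * (y + p))) / real k
            - r ^ k * sin (real k * (2 * pi * (y - p))) / real k) / pi
       = r ^ k * hit_coeff p k * cos (2 * pi * real k * y)" for k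
  proof -
    have "sin (real k * (2 * pi * (y + p))) - sin (real k * (2 * pi * (y - p)))
        = 2 * sin (2 * pi * real k * p) * cos (2 * pi * real k * y)"
      using sin_add[of "2 * pi * real k * y" "2 * pi * real k * p"]
            sin_diff[of "2 * pi * real k * y" "2 * pi * real k * p"]
      by (simp add: algebra_simps)
    then show ?thesis
      unfolding hit_coeff_def by (simp add: diff_divide_distrib[symmetric] right_diff_distrib[symmetric] mult_ac)
  qed
  ultimately show ?thesis by simp
qed

lemma abel_deviation_bounded:
  assumes "0 \<le> r" "r < 1"
  shows "\<bar>abel_deviation r p y\<bar> \<le> 2"
proof -
  have *: "\<bar>Im (Ln (1 - of_real r * cis x))\<bar> \<le> pi" for x
  proof -
    have "1 - of_real r * cis x \<noteq> 0"
    proof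
      assume "1 - complex_of_real r * cis x = 0"
      then have "cmod (of_real r * cis x) = 1" by (simp add: eq_iff_diff_eq_0[symmetric])
      then show False using assms by (simp add: norm_mult)
    qed
    from Im_Ln_le_pi[OF this] mpi_less_Im_Ln[OF this] show ?thesis by simp
  qed
  show ?thesis
    using *[of "2 * pi * (y - p)"] *[of "2 * pi * (y + p)"]
    unfolding abel_deviation_def by (simp add: abs_le_iff field_simps)
qed

text \<open>With \<open>\<theta> = \<pi> frac x\<close> one has \<open>1 - e(x) = 2 sin \<theta> cis (\<theta> - \<pi>/2)\<close>, and \<open>sin \<theta>\<close> is positive.\<close>

lemma Im_Ln_one_minus_cis:
  assumes "x \<notin> \<int>"
  shows "Re (1 - cis (2 * pi * x)) > 0" "Im (Ln (1 - cis (2 * pi * x))) = pi * (frac x - 1 / 2)"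
proof -
  define \<theta> where "\<theta> = pi * frac x"
  have fr: "0 < frac x" "frac x < 1"
    using assms frac_lt_1 by (auto simp: frac_gt_0_iff)
  have th: "0 < \<theta>" "\<theta> < pi" using fr by (auto simp: \<theta>_def)
  have "2 * pi * x = 2 * \<theta> + 2 * pi * of_int \<lfloor>x\<rfloor>"
    by (simp add: \<theta>_def frac_def algebra_simps)
  then have cis: "cis (2 * pi * x) = cis (2 * \<theta>)"
    by (simp add: cis_mult[symmetric] cis_multiple_2pi)
  have s: "sin \<theta> > 0" using th by (simp add: sin_gt_zero)
  have eq: "1 - cis (2 * \<theta>) = rcis (2 * sin \<theta>) (\<theta> - pi / 2)"
    using cos_double_sin[of \<theta>] sin_double[of \<theta>]
    by (simp add: complex_eq_iff cos_diff sin_diff power2_eq_square mult_ac)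
  show "Re (1 - cis (2 * pi * x)) > 0"
    unfolding cis eq using s th by (simp add: cos_diff)
  have "1 - cis (2 * \<theta>) \<noteq> 0"
    unfolding eq using s by simp
  then have "Im (Ln (1 - cis (2 * \<theta>))) = Arg (1 - cis (2 * \<theta>))"
    by (simp add: Arg_def)
  also have "\<dots> = \<theta> - pi / 2"
    unfolding eq by (rule Arg_rcis) (use s th in auto)
  finally show "Im (Ln (1 - cis (2 * pi * x))) = pi * (frac x - 1 / 2)"
    unfolding cis by (simp add: \<theta>_def algebra_simps)
qed

lemma abel_sawtooth_limit:
  assumes "x \<notin> \<int>" "r \<longlonglongrightarrow> 1"
  shows "(\<lambda>j. Im (Ln (1 - of_real (r j) * cis (2 * pi * x)))) \<longlonglongrightarrow> pi * (frac x - 1 / 2)"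
proof -
  have "(\<lambda>j. 1 - of_real (r j) * cis (2 * pi * x)) \<longlonglongrightarrow> 1 - of_real 1 * cis (2 * pi * x)"
    by (intro tendsto_intros assms)
  moreover have "1 - of_real 1 * cis (2 * pi * x) \<notin> \<real>\<^sub>\<le>\<^sub>0"
    using Im_Ln_one_minus_cis(1)[OF assms(1)] by (auto simp: complex_nonpos_Reals_iff)
  ultimately have "(\<lambda>j. Im (Ln (1 - of_real (r j) * cis (2 * pi * x)))) \<longlonglongrightarrow> Im (Ln (1 - of_real 1 * cis (2 * pi * x)))"
    by (intro tendsto_Im tendsto_Ln)
  then show ?thesis using Im_Ln_one_minus_cis(2)[OF assms(1)] by simp
qed

text \<open>The difference of the floors counts the integers in \<open>(y - p, y + p]\<close>. This
  interval has length at most 1, so it contains at most one integer, and if it contains one, then also a nearest one to \<open>y\<close>.\<close>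

lemma floor_difference_eq_hit:
  assumes "y - p \<notin> \<int>" "y + p \<notin> \<int>" "0 \<le> p" "p \<le> 1 / 2"
  shows "of_int (\<lfloor>y + p\<rfloor> - \<lfloor>y - p\<rfloor>) = (of_bool (dist_nearest_int y \<le> p) :: real)"
proof -
  have lt: "of_int \<lfloor>y - p\<rfloor> < y - p" "of_int \<lfloor>y + p\<rfloor> < y + p"
    using assms(1,2) by (metis Ints_of_int of_int_floor_le order_le_less)+
  show ?thesis
  proof (cases "dist_nearest_int y \<le> p")
    case True
    then have "\<lfloor>y - p\<rfloor> < round y" "of_int (round y) \<le> y + p"
      using lt unfolding dist_nearest_int_def by (simp_all add: abs_le_iff floor_less_iff)
         (metis Ints_of_int assms(1) less_eq_real_def diff_le_eq add.commute)
    moreover have "\<lfloor>y + p\<rfloor> \<le> \<lfloor>y - p\<rfloor> + 1"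
      using lt assms by linarith
    ultimately have "\<lfloor>y + p\<rfloor> = \<lfloor>y - p\<rfloor> + 1"
      by linarith
    then show ?thesis using True by simp
  next
    case False
    have "\<lfloor>y + p\<rfloor> \<le> \<lfloor>y - p\<rfloor>"
    proof (rule ccontr)
      assume "\<not> \<lfloor>y + p\<rfloor> \<le> \<lfloor>y - p\<rfloor>"
      then have "y - p < of_int \<lfloor>y + p\<rfloor>" by linarith
      then have "\<bar>y - of_int \<lfloor>y + p\<rfloor>\<bar> \<le> p" using lt by linarith
      moreover have "\<bar>y - of_int (round y)\<bar> \<le> \<bar>y - of_int \<lfloor>y + p\<rfloor>\<bar>"
        using round_diff_minimal[of y "\<lfloor>y + p\<rfloor>"] by simp
      ultimately show False using False by (simp add: dist_nearest_int_def)
    qed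
    moreover have "\<lfloor>y - p\<rfloor> \<le> \<lfloor>y + p\<rfloor>"
      using assms by (intro floor_mono) simp
    ultimately show ?thesis using False by simp
  qed
qed

lemma abel_deviation_tendsto:
  assumes "y - p \<notin> \<int>" "y + p \<notin> \<int>" "0 \<le> p" "p \<le> 1 / 2" "r \<longlonglongrightarrow> 1"
  shows "(\<lambda>j. abel_deviation (r j) p y) \<longlonglongrightarrow> hit_deviation p y"
proof -
  have "(\<lambda>j. abel_deviation (r j) p y) \<longlonglongrightarrow>
          (pi * (frac (y - p) - 1 / 2) - pi * (frac (y + p) - 1 / 2)) / pi"
    unfolding abel_deviation_def
    by (intro tendsto_intros abel_sawtooth_limit assms) simp
  also have "(pi * (frac (y - p) - 1 / 2) - pi * (frac (y + p) - 1 / 2)) / pi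
      = frac (y - p) - frac (y + p)"
    by (simp add: field_simps)
  also have "\<dots> = of_int (\<lfloor>y + p\<rfloor> - \<lfloor>y - p\<rfloor>) - 2 * p"
    by (simp add: frac_def)
  also have "\<dots> = hit_deviation p y"
    unfolding floor_difference_eq_hit[OF assms(1-4)] hit_deviation_def ..
  finally show ?thesis .
qed

lemma measurable_dist_nearest_int [measurable]: "dist_nearest_int \<in> borel_measurable borel"
  unfolding dist_nearest_int_def round_def by measurable

lemma measurable_hit_deviation [measurable]: "hit_deviation p \<in> borel_measurable borel"
  unfolding hit_deviation_def by measurable

lemma sum_geometric_le:
  fixes \<rho> :: real
  assumes "0 \<le> \<rho>" "\<rho> < 1" "finite A" "inj_on f A"
  shows "(\<Sum>i\<in>A. \<rho> ^ f i) \<le> 1 / (1 - \<rho>)"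
proof -
  have "(\<Sum>i\<in>A. \<rho> ^ f i) = sum (\<lambda>k. \<rho> ^ k) (f ` A)"
    using assms by (simp add: sum.reindex)
  also have "\<dots> \<le> suminf (\<lambda>k. \<rho> ^ k)"
    using assms by (intro sum_le_suminf summable_geometric) auto
  also have "\<dots> = 1 / (1 - \<rho>)" using assms by (simp add: suminf_geometric)
  finally show ?thesis .
qed

definition partial_deviation :: "real \<Rightarrow> nat \<Rightarrow> real \<Rightarrow> real \<Rightarrow> real" where
  "partial_deviation r K p y = (\<Sum>k<K. r ^ k * hit_coeff p k * cos (2 * pi * real k * y))"

lemma measurable_partial_deviation [measurable]: "partial_deviation r K p \<in> borel_measurable borel"
  unfolding partial_deviation_def by measurable

lemma partial_deviation_tendsto:
  assumes "0 \<le> r" "r < 1"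
  shows "(\<lambda>K. partial_deviation r K p y) \<longlonglongrightarrow> abel_deviation r p y"
  using abel_deviation_sums[OF assms] unfolding sums_def partial_deviation_def .

lemma measurable_abel_deviation:
  assumes "0 \<le> r" "r < 1"
  shows "abel_deviation r p \<in> borel_measurable borel"
  by (rule borel_measurable_LIMSEQ_real[OF partial_deviation_tendsto[OF assms]]) measurable

text \<open>For fixed \<open>r < 1\<close> the Fourier series converges absolutely; the bound serves only as a
  dominating constant.\<close>

lemma partial_deviation_bounded:
  assumes "0 \<le> r" "r < 1"
  shows "\<bar>partial_deviation r K p y\<bar> \<le> 1 / (1 - r)"
proof -
  have "\<bar>partial_deviation r K p y\<bar> \<le> (\<Sum>k<K. \<bar>r ^ k * hit_coeff p k * cos (2 * pi * real k * y)\<bar>)"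
    unfolding partial_deviation_def by (rule sum_abs)
  also have "\<dots> \<le> (\<Sum>k<K. r ^ k)"
  proof (rule sum_mono)
    fix k
    have "\<bar>hit_coeff p k\<bar> * \<bar>cos (2 * pi * real k * y)\<bar> \<le> 1 * 1"
      by (intro mult_mono abs_hit_coeff_le_1 abs_cos_le_one) auto
    then show "\<bar>r ^ k * hit_coeff p k * cos (2 * pi * real k * y)\<bar> \<le> r ^ k"
      using mult_left_mono[of _ 1 "r ^ k"] assms by (simp add: abs_mult mult.assoc)
  qed
  also have "\<dots> \<le> 1 / (1 - r)"
    using assms by (intro sum_geometric_le) auto
  finally show ?thesis .
qed

section \<open>Frequencies of pairs in a lacunary sequence\<close>

text \<open>If both coordinates of \<open>k (m, -1) - l (q, -1)\<close> are at most \<open>R\<close>, eliminating \<open>l\<close> or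
  \<open>k\<close> bounds \<open>k (q - m)\<close> and \<open>l (q - m)\<close> by \<open>2 q R\<close> and \<open>2 m R\<close>. Lacunarity enters through
  \<open>q - m \<ge> (1 - 1/c) q\<close>.\<close>

lemma lacunary_frequency_bounds:
  fixes m q k l c R :: real
  assumes c: "c > 1" and m: "m \<ge> 1" and q: "q \<ge> c * m" and pos: "k \<ge> 0" "l \<ge> 0"
    and R: "\<bar>k * m - l * q\<bar> \<le> R" "\<bar>k - l\<bar> \<le> R"
  shows "k \<le> 2 * c / (c - 1) * R" "l * (q / m) \<le> 2 * c / (c - 1) * R"
proof -
  have q1: "q \<ge> 1" "q > 0"
    using mult_mono[of 1 c 1 m] c m q by auto
  have gap: "(c - 1) * q \<le> c * (q - m)"
    using q by (simp add: algebra_simps)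
  have R0: "R \<ge> 0" using R(2) by linarith
  have Rm: "R \<le> m * R" "R \<le> q * R"
    using mult_right_mono[OF m R0] mult_right_mono[OF q1(1) R0] by auto
  have "k * (q - m) = q * (k - l) - (k * m - l * q)" by (simp add: algebra_simps)
  also have "\<dots> \<le> q * R + R"
    using mult_left_mono[of "k - l" R q] R q1 by linarith
  finally have k: "k * (q - m) \<le> 2 * (q * R)" using Rm by linarith
  have "((c - 1) * k) * q = k * ((c - 1) * q)" by simp
  also have "\<dots> \<le> k * (c * (q - m))" by (rule mult_left_mono[OF gap pos(1)])
  also have "\<dots> \<le> (2 * c * R) * q" using mult_left_mono[OF k, of c] c by (simp add: mult_ac)
  finally have "(c - 1) * k \<le> 2 * c * R" using q1 by simp
  then show "k \<le> 2 * c / (c - 1) * R" using c by (simp add: field_simps)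
  have "l * (q - m) = m * (k - l) - (k * m - l * q)" by (simp add: algebra_simps)
  also have "\<dots> \<le> m * R + R"
    using mult_left_mono[of "k - l" R m] R m by linarith
  finally have l: "l * (q - m) \<le> 2 * (m * R)" using Rm by linarith
  have "((c - 1) * (l * (q / m))) * m = l * ((c - 1) * q)" using m by simp
  also have "\<dots> \<le> l * (c * (q - m))" by (rule mult_left_mono[OF gap pos(2)])
  also have "\<dots> \<le> (2 * c * R) * m" using mult_left_mono[OF l, of c] c by (simp add: mult_ac)
  finally have "(c - 1) * (l * (q / m)) \<le> 2 * c * R"
    by (rule mult_right_le_imp_le) (use m in simp)
  then show "l * (q / m) \<le> 2 * c / (c - 1) * R" using c by (simp add: field_simps)
qed

text \<open>The value \<open>\<zeta>(1 + \<eta>)\<close>; the term at 0 vanishes since \<open>0 powr s = 0\<close>.\<close>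

definition zeta_sum :: "real \<Rightarrow> real" where
  "zeta_sum \<eta> = (\<Sum>k. real k powr (- 1 - \<eta>))"

lemma sum_powr_le_zeta_sum:
  assumes "\<eta> > 0"
  shows "(\<Sum>k<K. real k powr (- 1 - \<eta>)) \<le> zeta_sum \<eta>"
  unfolding zeta_sum_def using assms by (intro sum_le_suminf) (auto simp: summable_real_powr_iff)

lemma zeta_sum_nonneg: "\<eta> > 0 \<Longrightarrow> zeta_sum \<eta> \<ge> 0"
  using sum_powr_le_zeta_sum[of \<eta> 0] by simp

text \<open>Distinct multiples of \<open>m\<close> are at least \<open>m\<close> apart, so at most one of them lies within \<open>m/2\<close>
  of \<open>y\<close>.\<close>

lemma sum_near_multiples_le_1:
  fixes m :: nat
  assumes "m \<ge> 1" "finite A"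
  shows "(\<Sum>k\<in>A. of_bool (2 * \<bar>real k * real m - y\<bar> < real m) :: real) \<le> 1"
proof -
  have "card {k \<in> A. 2 * \<bar>real k * real m - y\<bar> < real m} \<le> 1"
  proof -
    have "k = k'" if "2 * \<bar>real k * real m - y\<bar> < real m" "2 * \<bar>real k' * real m - y\<bar> < real m" for k k'
    proof -
      have "\<bar>(real k - real k') * real m\<bar> < 1 * real m"
        using that abs_triangle_ineq4[of "real k * real m - y" "real k' * real m - y"]
        by (simp add: left_diff_distrib)
      then have "\<bar>real k - real k'\<bar> < 1"
        using assms(1) by (simp add: abs_mult)
      then show ?thesis by linarith
    qed
    then show ?thesis using assms(2) by (auto simp: card_le_Suc0_iff_eq)
  qed
  moreover have "(\<Sum>k\<in>A. of_bool (2 * \<bar>real k * real m - y\<bar> < real m) :: real)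
      = real (card {k \<in> A. 2 * \<bar>real k * real m - y\<bar> < real m})"
    using assms(2) by (simp add: of_bool_def sum.If_cases Int_def)
  ultimately show ?thesis by simp
qed

section \<open>Cosine moments of a measure with decaying Fourier transform\<close>

lemma (in prob_space) abs_expectation_limit_le:
  fixes F :: "nat \<Rightarrow> 'a \<Rightarrow> real"
  assumes [measurable]: "\<And>j. F j \<in> borel_measurable M" "G \<in> borel_measurable M"
    and bd: "\<And>j x. x \<in> space M \<Longrightarrow> \<bar>F j x\<bar> \<le> B"
    and lim: "AE x in M. (\<lambda>j. F j x) \<longlonglongrightarrow> G x"
    and D: "\<And>j. \<bar>expectation (F j)\<bar> \<le> D"
  shows "\<bar>expectation G\<bar> \<le> D"
proof -
  have "(\<lambda>j. expectation (F j)) \<longlonglongrightarrow> expectation G"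
    by (rule integral_dominated_convergence[where w = "\<lambda>_. B"]) (use bd lim in auto)
  then have "(\<lambda>j. \<bar>expectation (F j)\<bar>) \<longlonglongrightarrow> \<bar>expectation G\<bar>"
    by (intro tendsto_intros)
  then show ?thesis by (rule LIMSEQ_le_const2) (use D in auto)
qed

text \<open>Off the integers the sums are bounded, being geometric. The starting frequency \<open>L\<close> is
  arbitrary so that only high frequencies need to be used.\<close>

lemma average_of_cosines_tendsto:
  "(\<lambda>K. (\<Sum>i<Suc K. cos (2 * pi * real (L + i) * y)) / real (Suc K)) \<longlonglongrightarrow> of_bool (y \<in> \<int>)"
proof (cases "y \<in> \<int>")
  case True
  then obtain a where a: "y = of_int a" by (elim Ints_cases)
  have "cos (2 * pi * real k * y) = 1" for k
    using cos_int_2pin[of "int k * a"] by (simp add: a mult_ac)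
  then show ?thesis using True by (simp del: of_nat_Suc of_nat_add sum.lessThan_Suc)
next
  case False
  define z where "z = cis (2 * pi * y)"
  have z1: "z \<noteq> 1"
    using Im_Ln_one_minus_cis(1)[OF False] unfolding z_def[symmetric] by auto
  have cos_eq: "cos (2 * pi * real k * y) = Re (z ^ k)" for k
    by (simp add: z_def Complex.DeMoivre mult_ac)
  have "(\<Sum>i<Suc K. cos (2 * pi * real (L + i) * y)) = Re (z ^ L * (\<Sum>i<Suc K. z ^ i))" for K
    by (simp only: cos_eq sum_distrib_left power_add Re_sum)
  also have "\<dots> K = Re (z ^ L * ((1 - z ^ Suc K) / (1 - z)))" for K
    using z1 by (simp add: sum_gp_strict del: sum.lessThan_Suc)
  finally have eq: "(\<Sum>i<Suc K. cos (2 * pi * real (L + i) * y)) = Re (z ^ L * ((1 - z ^ Suc K) / (1 - z)))" for K .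
  have "(\<lambda>K. (\<Sum>i<Suc K. cos (2 * pi * real (L + i) * y)) / real (Suc K)) \<longlonglongrightarrow> 0"
  proof (rule Lim_null_comparison)
    show "eventually (\<lambda>K. norm ((\<Sum>i<Suc K. cos (2 * pi * real (L + i) * y)) / real (Suc K)) \<le> 2 / cmod (1 - z) * (1 / real (Suc K))) sequentially"
    proof (rule always_eventually, rule allI)
      fix K
      have nz: "cmod z = 1" by (simp add: z_def)
      have "\<bar>Re (z ^ L * ((1 - z ^ Suc K) / (1 - z)))\<bar> \<le> cmod (z ^ L * ((1 - z ^ Suc K) / (1 - z)))"
        by (rule abs_Re_le_cmod)
      also have "\<dots> = cmod (1 - z ^ Suc K) / cmod (1 - z)"
        using nz by (simp add: norm_mult norm_divide norm_power)
      also have "\<dots> \<le> 2 / cmod (1 - z)"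
        using norm_triangle_ineq4[of 1 "z ^ Suc K"] nz by (intro divide_right_mono) (auto simp: norm_power norm_mult)
      finally show "norm ((\<Sum>i<Suc K. cos (2 * pi * real (L + i) * y)) / real (Suc K)) \<le> 2 / cmod (1 - z) * (1 / real (Suc K))"
        unfolding real_norm_def eq abs_divide abs_of_nat times_divide_eq_right[of _ 1] mult_1_right
        by (rule divide_right_mono) simp
    qed
    show "(\<lambda>K. 2 / cmod (1 - z) * (1 / real (Suc K))) \<longlonglongrightarrow> 0"
      by (intro tendsto_mult_right_zero) (use LIMSEQ_inverse_real_of_nat in \<open>simp add: inverse_eq_divide\<close>)
  qed
  then show ?thesis using False by simp
qed

definition phase :: "nat \<Rightarrow> real \<times> real \<Rightarrow> real" where
  "phase m x = real m * fst x - snd x"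

lemma measurable_phase [measurable]: "phase m \<in> borel_measurable borel"
  unfolding phase_def by (intro borel_measurable_continuous_onI continuous_intros)

locale decaying_measure = prob_space \<mu> for \<mu> :: "(real \<times> real) measure" +
  fixes C \<delta> :: real
  assumes sets_eq [measurable_cong]: "sets \<mu> = sets borel"
    and C_pos: "C > 0" and \<delta>_pos: "\<delta> > 0"
    and decay: "\<And>\<xi>. norm (fourier_transform \<mu> \<xi>) \<le> C * (1 + norm \<xi>) powr (- \<delta>)"
begin

lemma space_eq [simp]: "space \<mu> = UNIV"
  using sets_eq_imp_space_eq[OF sets_eq] by simp

text \<open>The phase \<open>\<phi>\<close> only multiplies the Fourier coefficient by a unit.\<close>

lemma abs_cosine_moment_le:
  assumes R: "0 < R" "R \<le> norm \<xi>"
  shows "\<bar>\<integral>x. cos (2 * pi * (\<xi> \<bullet> x) - \<phi>) \<partial>\<mu>\<bar> \<le> C * R powr (- \<delta>)"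
proof -
  define f where "f x = exp (- 2 * complex_of_real pi * \<i> * complex_of_real (\<xi> \<bullet> x))" for x
  have f: "f x = cis (- (2 * pi * (\<xi> \<bullet> x)))" for x
    by (simp add: f_def cis_conv_exp mult_ac)
  have "integrable \<mu> f"
  proof (rule integrable_const_bound[where B = 1])
    have "f \<in> borel_measurable borel"
      unfolding f_def by (intro borel_measurable_continuous_onI continuous_intros)
    then show "f \<in> borel_measurable \<mu>" by measurable
  qed (simp add: f)
  then have int: "integrable \<mu> (\<lambda>x. cis \<phi> * f x)" by simp
  have "(\<integral>x. cos (2 * pi * (\<xi> \<bullet> x) - \<phi>) \<partial>\<mu>) = (\<integral>x. Re (cis \<phi> * f x) \<partial>\<mu>)"
    by (intro Bochner_Integration.integral_cong refl) (simp add: f cis_mult cos_diff cos_add mult_ac)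
  also have "\<dots> = Re (\<integral>x. cis \<phi> * f x \<partial>\<mu>)"
    by (rule integral_Re[OF int])
  also have "(\<integral>x. cis \<phi> * f x \<partial>\<mu>) = cis \<phi> * fourier_transform \<mu> \<xi>"
    by (simp add: fourier_transform_def f_def[abs_def])
  finally have "\<bar>\<integral>x. cos (2 * pi * (\<xi> \<bullet> x) - \<phi>) \<partial>\<mu>\<bar> \<le> norm (cis \<phi> * fourier_transform \<mu> \<xi>)"
    by (simp only: abs_Re_le_cmod)
  also have "\<dots> \<le> C * (1 + norm \<xi>) powr (- \<delta>)"
    using decay by (simp add: norm_mult)
  also have "\<dots> \<le> C * R powr (- \<delta>)"
    using C_pos \<delta>_pos R by (intro mult_left_mono powr_mono2') auto
  finally show ?thesis .
qed

text \<open>The indicator of the lines \<open>m \<alpha> - \<gamma> - \<beta> \<in> \<int>\<close> is, for every \<open>L\<close>, a limit of averages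
  of cosines whose frequencies all exceed \<open>L\<close> (as in Wiener's theorem on atoms). By decay the mass of the lines is at most
  \<open>C (L + 1)^(-\<delta>)\<close>, and \<open>L\<close> is arbitrary.\<close>

lemma AE_phase_minus_not_int: "AE x in \<mu>. phase m x - \<beta> \<notin> \<int>"
proof -
  define G where "G x = (of_bool (phase m x - \<beta> \<in> \<int>) :: real)" for x
  define F where "F L K x = (\<Sum>i<Suc K. cos (2 * pi * real (L + i) * (phase m x - \<beta>))) / real (Suc K)" for L K x
  have F [measurable]: "F L K \<in> borel_measurable \<mu>" for L K
    unfolding F_def by measurable
  have lim: "(\<lambda>K. F L K x) \<longlonglongrightarrow> G x" for L x
    unfolding F_def G_def by (rule average_of_cosines_tendsto)
  have G [measurable]: "G \<in> borel_measurable \<mu>"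
    by (rule borel_measurable_LIMSEQ_real[OF lim[of 0]]) measurable
  have "\<bar>expectation G\<bar> \<le> C * real (Suc L) powr (- \<delta>)" for L
  proof (rule abs_expectation_limit_le[where F = "F (Suc L)" and B = 1])
    fix K
    show "\<bar>F (Suc L) K x\<bar> \<le> 1" for x
    proof -
      have "\<bar>\<Sum>i<Suc K. cos (2 * pi * real (Suc L + i) * (phase m x - \<beta>))\<bar> \<le> (\<Sum>i<Suc K. 1)"
        by (rule order.trans[OF sum_abs]) (intro sum_mono abs_cos_le_one)
      then show ?thesis by (simp add: F_def del: sum.lessThan_Suc)
    qed
    have moment: "\<bar>\<integral>x. cos (2 * pi * real (Suc L + i) * (phase m x - \<beta>)) \<partial>\<mu>\<bar> \<le> C * real (Suc L) powr (- \<delta>)" for i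
    proof -
      define k where "k = real (Suc L + i)"
      have "cos (2 * pi * k * (phase m x - \<beta>)) = cos (2 * pi * ((k * real m, - k) \<bullet> x) - 2 * pi * k * \<beta>)" for x
        by (cases x) (simp add: phase_def algebra_simps)
      moreover have "real (Suc L) \<le> norm (k * real m, - k)"
        by (rule order.trans[OF _ norm_snd_le]) (simp add: k_def)
      ultimately show ?thesis
        unfolding k_def[symmetric] by (simp only:) (rule abs_cosine_moment_le, auto)
    qed
    have int: "integrable \<mu> (\<lambda>x. cos (2 * pi * real (Suc L + i) * (phase m x - \<beta>)))" for i
      by (rule integrable_const_bound[where B = 1]) (simp_all add: abs_cos_le_one)
    have "expectation (F (Suc L) K) = (\<Sum>i<Suc K. \<integral>x. cos (2 * pi * real (Suc L + i) * (phase m x - \<beta>)) \<partial>\<mu>) / real (Suc K)"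
      unfolding F_def by (simp only: integral_divide_zero Bochner_Integration.integral_sum[OF int])
    also have "\<bar>\<dots>\<bar> \<le> (\<Sum>i<Suc K. C * real (Suc L) powr (- \<delta>)) / real (Suc K)"
      unfolding abs_divide abs_of_nat
      by (intro divide_right_mono order.trans[OF sum_abs] sum_mono moment) auto
    finally show "\<bar>expectation (F (Suc L) K)\<bar> \<le> C * real (Suc L) powr (- \<delta>)"
      by (simp del: sum.lessThan_Suc of_nat_Suc)
  qed (use lim in auto)
  moreover have "(\<lambda>L. C * real (Suc L) powr (- \<delta>)) \<longlonglongrightarrow> 0"
  proof -
    have "filterlim (\<lambda>L. real (Suc L)) at_top sequentially"
      by (rule filterlim_compose[OF filterlim_real_sequentially filterlim_Suc])
    then show ?thesis
      using \<delta>_pos by (intro tendsto_mult_right_zero tendsto_neg_powr) auto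
  qed
  ultimately have "\<bar>expectation G\<bar> \<le> 0"
    by (intro LIMSEQ_le_const[of _ 0 "\<bar>expectation G\<bar>"]) auto
  then have "expectation G = 0" by simp
  moreover have "integrable \<mu> G"
    by (rule integrable_const_bound[where B = 1]) (auto simp: G_def)
  ultimately have "AE x in \<mu>. G x = 0"
    by (subst (asm) integral_nonneg_eq_0_iff_AE) (auto simp: G_def)
  then show ?thesis by eventually_elim (simp add: G_def)
qed

text \<open>Bounds for trigonometric polynomials pass to the true indicators by two applications of dominated
  convergence: first the number of terms tends to infinity, then \<open>r\<close> tends to 1. Products over a
  finite set cover first and second moments at once.\<close>

lemma abs_expectation_prod_hit_deviation_le:
  fixes p :: "nat \<Rightarrow> real"
  assumes p: "\<And>t. t \<in> S \<Longrightarrow> 0 \<le> p t \<and> p t \<le> 1 / 2"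
    and bound: "\<And>r K. 0 \<le> r \<Longrightarrow> r < 1 \<Longrightarrow>
      \<bar>\<integral>x. (\<Prod>t\<in>S. partial_deviation r K (p t) (phase (n t) x)) \<partial>\<mu>\<bar> \<le> D"
    and "finite S"
  shows "\<bar>\<integral>x. (\<Prod>t\<in>S. hit_deviation (p t) (phase (n t) x)) \<partial>\<mu>\<bar> \<le> D"
proof -
  have bd: "\<bar>\<Prod>t\<in>S. f t\<bar> \<le> B ^ card S" if "\<And>t. \<bar>f t\<bar> \<le> B" for f :: "nat \<Rightarrow> real" and B
  proof -
    have "\<bar>\<Prod>t\<in>S. f t\<bar> \<le> (\<Prod>t\<in>S. B)"
      unfolding abs_prod using that by (intro prod_mono) auto
    then show ?thesis by simp
  qed
  have abel: "\<bar>\<integral>x. (\<Prod>t\<in>S. abel_deviation r (p t) (phase (n t) x)) \<partial>\<mu>\<bar> \<le> D" if r: "0 \<le> r" "r < 1" for r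
  proof (rule abs_expectation_limit_le[where
        F = "\<lambda>K x. \<Prod>t\<in>S. partial_deviation r K (p t) (phase (n t) x)" and B = "(1 / (1 - r)) ^ card S"])
    note [measurable] = measurable_abel_deviation[OF r]
    show "(\<lambda>x. \<Prod>t\<in>S. abel_deviation r (p t) (phase (n t) x)) \<in> borel_measurable \<mu>"
      by measurable
    show "(\<lambda>x. \<Prod>t\<in>S. partial_deviation r K (p t) (phase (n t) x)) \<in> borel_measurable \<mu>" for K
      by measurable
    show "AE x in \<mu>. (\<lambda>K. \<Prod>t\<in>S. partial_deviation r K (p t) (phase (n t) x)) \<longlonglongrightarrow> (\<Prod>t\<in>S. abel_deviation r (p t) (phase (n t) x))"
      by (intro AE_I2 tendsto_prod partial_deviation_tendsto r)
  qed (use bd partial_deviation_bounded[OF r] bound[OF r] in auto)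
  define r where "r j = real j / real (Suc j)" for j :: nat
  have r: "0 \<le> r j" "r j < 1" for j by (auto simp: r_def)
  have r1: "r \<longlonglongrightarrow> 1" unfolding r_def using LIMSEQ_n_over_Suc_n[where 'a = real] by simp
  show ?thesis
  proof (rule abs_expectation_limit_le[where
        F = "\<lambda>j x. \<Prod>t\<in>S. abel_deviation (r j) (p t) (phase (n t) x)" and B = "2 ^ card S"])
    note [measurable] = measurable_abel_deviation[OF r]
    show "(\<lambda>x. \<Prod>t\<in>S. abel_deviation (r j) (p t) (phase (n t) x)) \<in> borel_measurable \<mu>" for j
      by measurable
    show "(\<lambda>x. \<Prod>t\<in>S. hit_deviation (p t) (phase (n t) x)) \<in> borel_measurable \<mu>"
      by measurable
    have "AE x in \<mu>. \<forall>t\<in>S. phase (n t) x - p t \<notin> \<int>" "AE x in \<mu>. \<forall>t\<in>S. phase (n t) x - (- p t) \<notin> \<int>"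
      using \<open>finite S\<close> AE_phase_minus_not_int by (auto simp: AE_finite_all simp del: diff_minus_eq_add)
    then show "AE x in \<mu>. (\<lambda>j. \<Prod>t\<in>S. abel_deviation (r j) (p t) (phase (n t) x)) \<longlonglongrightarrow> (\<Prod>t\<in>S. hit_deviation (p t) (phase (n t) x))"
    proof eventually_elim
      case (elim x)
      then show ?case by (intro tendsto_prod abel_deviation_tendsto r1) (use p in auto)
    qed
  qed (use bd abel_deviation_bounded[OF r] abel[OF r] in auto)
qed

text \<open>Decay in a form suited to geometric means: when the norm dominates each of three
  quantities up to the factor \<open>\<kappa>\<close>, their product \<open>Q\<close> inherits the decay exponent \<open>\<delta>/3\<close>.\<close>

lemma abs_cosine_moment_le_cube:
  assumes "Q > 0" "\<kappa> \<ge> 1" "Q \<le> (\<kappa> * norm \<xi>) ^ 3"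
  shows "\<bar>\<integral>x. cos (2 * pi * (\<xi> \<bullet> x)) \<partial>\<mu>\<bar> \<le> C * \<kappa> powr \<delta> * Q powr (- (\<delta> / 3))"
proof -
  define R where "R = Q powr (1 / 3) / \<kappa>"
  have "(Q powr (1 / 3)) ^ 3 = Q" using assms by (simp add: powr_power)
  then have "Q powr (1 / 3) \<le> \<kappa> * norm \<xi>"
    using assms power_mono_iff[of "Q powr (1 / 3)" "\<kappa> * norm \<xi>" 3] by simp
  then have "R \<le> norm \<xi>" "R > 0" using assms by (auto simp: R_def field_simps)
  from abs_cosine_moment_le[OF this(2,1), of 0]
  have "\<bar>\<integral>x. cos (2 * pi * (\<xi> \<bullet> x)) \<partial>\<mu>\<bar> \<le> C * R powr (- \<delta>)" by simp
  also have "R powr (- \<delta>) = \<kappa> powr \<delta> * Q powr (- (\<delta> / 3))"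
    using assms by (simp add: R_def powr_divide powr_powr powr_minus divide_simps)
  finally show ?thesis by (simp add: mult.assoc)
qed

lemma abs_single_cosine_le:
  assumes "k \<ge> 1" "m \<ge> 1"
  shows "\<bar>\<integral>x. cos (2 * pi * real k * phase m x) \<partial>\<mu>\<bar> \<le> C * (real k * real m) powr (- (\<delta> / 3))"
proof -
  have "1 \<le> real k * real m" using assms by (simp flip: of_nat_mult)
  moreover have "real k * real m \<le> norm (real k * real m, - real k)"
    by (rule order.trans[OF _ norm_fst_le]) simp
  ultimately have "1 * real k * real m \<le> (1 * norm (real k * real m, - real k)) ^ 3"
    using self_le_power[of "norm (real k * real m, - real k)" 3] by simp
  then have "\<bar>\<integral>x. cos (2 * pi * ((real k * real m, - real k) \<bullet> x)) \<partial>\<mu>\<bar>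
      \<le> C * 1 powr \<delta> * (real k * real m) powr (- (\<delta> / 3))"
    using assms by (intro abs_cosine_moment_le_cube) auto
  moreover have "cos (2 * pi * real k * phase m x) = cos (2 * pi * ((real k * real m, - real k) \<bullet> x))" for x
    by (cases x) (simp add: phase_def algebra_simps)
  ultimately show ?thesis
    by (simp only: powr_one_eq_one mult_1_right)
qed

text \<open>The product of cosines splits into the frequencies \<open>\<xi> = k (m, -1) + l (q, -1)\<close> and
  \<open>\<zeta> = k (m, -1) - l (q, -1)\<close>. The norm of the first dominates \<open>q\<close>, \<open>k\<close> and \<open>l\<close>. The norm of the second dominates \<open>k\<close> and
  \<open>l q / m\<close>; away from the resonance \<open>k m = l q\<close> it dominates \<open>m\<close> too, and the
  three multiply to \<open>q k l\<close>. Near resonance only the bound by \<open>l q / m\<close> is used.\<close>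

lemma abs_cosine_pair_le:
  assumes c: "c > 1" and m: "m \<ge> 1" and q: "real q \<ge> c * real m" and kl: "k \<ge> 1" "l \<ge> 1"
  shows "\<bar>\<integral>x. cos (2 * pi * real k * phase m x) * cos (2 * pi * real l * phase q x) \<partial>\<mu>\<bar>
    \<le> C * (2 * c / (c - 1)) powr \<delta> *
       ((real q * real k * real l) powr (- (\<delta> / 3)) +
        of_bool (2 * \<bar>real k * real m - real l * real q\<bar> < real m) * (real l * (real q / real m)) powr (- (\<delta> / 3)))"
proof -
  define \<kappa> where "\<kappa> = 2 * c / (c - 1)"
  have \<kappa>: "\<kappa> \<ge> 2" using c by (simp add: \<kappa>_def field_simps)
  define A where "A = C * \<kappa> powr \<delta>"
  have A: "A \<ge> 0" using C_pos by (simp add: A_def)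
  define Q where "Q = (real q * real k * real l) powr (- (\<delta> / 3))"
  have mq: "real m \<le> real q" using q mult_right_mono[of 1 c "real m"] c by simp
  have rk: "real k \<ge> 1" "real l \<ge> 1" "real m \<ge> 1" "real q \<ge> 1" using kl m mq by auto
  have Qpos: "real q * real k * real l > 0" using rk by auto
  define \<xi> where "\<xi> = (real k * real m + real l * real q, - (real k + real l))"
  define \<zeta> where "\<zeta> = (real k * real m - real l * real q, - (real k - real l))"
  have plus: "\<bar>\<integral>x. cos (2 * pi * (\<xi> \<bullet> x)) \<partial>\<mu>\<bar> \<le> A * Q"
    unfolding A_def Q_def
  proof (rule abs_cosine_moment_le_cube[OF Qpos])
    have fst: "real k * real m + real l * real q \<le> norm \<xi>"
      unfolding \<xi>_def by (rule order.trans[OF _ norm_fst_le]) simp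
    have snd: "real k + real l \<le> norm \<xi>"
      unfolding \<xi>_def by (rule order.trans[OF _ norm_snd_le]) simp
    have "real q \<le> real l * real q" using mult_right_mono[OF rk(2), of "real q"] by simp
    then have "real q \<le> norm \<xi>" using fst mult_nonneg_nonneg[of "real k" "real m"] by linarith
    moreover have "real k \<le> norm \<xi>" "real l \<le> norm \<xi>" using snd by auto
    ultimately have "real q * real k * real l \<le> norm \<xi> * norm \<xi> * norm \<xi>"
      by (intro mult_mono) auto
    also have "\<dots> \<le> (\<kappa> * norm \<xi>) ^ 3"
      using power_mono[of "norm \<xi>" "\<kappa> * norm \<xi>" 3] mult_right_mono[of 1 \<kappa> "norm \<xi>"] \<kappa>
      by (simp add: power3_eq_cube)
    finally show "real q * real k * real l \<le> (\<kappa> * norm \<xi>) ^ 3" .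
  qed (use \<kappa> in simp)
  have R: "\<bar>real k * real m - real l * real q\<bar> \<le> norm \<zeta>" "\<bar>real k - real l\<bar> \<le> norm \<zeta>"
    unfolding \<zeta>_def by (rule order.trans[OF _ norm_fst_le], simp) (rule order.trans[OF _ norm_snd_le], simp)
  have k_le: "real k \<le> \<kappa> * norm \<zeta>" and l_le: "real l * (real q / real m) \<le> \<kappa> * norm \<zeta>"
    using lacunary_frequency_bounds[OF c rk(3) q _ _ R] unfolding \<kappa>_def by auto
  have minus: "\<bar>\<integral>x. cos (2 * pi * (\<zeta> \<bullet> x)) \<partial>\<mu>\<bar> \<le> A * (Q +
      of_bool (2 * \<bar>real k * real m - real l * real q\<bar> < real m) * (real l * (real q / real m)) powr (- (\<delta> / 3)))"
  proof (cases "2 * \<bar>real k * real m - real l * real q\<bar> < real m")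
    case True
    define S where "S = real l * (real q / real m)"
    have "real q / real m \<ge> 1" using mq rk by simp
    then have S: "S \<ge> 1" using mult_mono[of 1 "real l" 1 "real q / real m"] rk by (simp add: S_def)
    then have "S \<le> S ^ 3" using self_le_power[of S 3] by simp
    also have "\<dots> \<le> (\<kappa> * norm \<zeta>) ^ 3"
      using l_le S by (intro power_mono) (auto simp: S_def)
    finally have "\<bar>\<integral>x. cos (2 * pi * (\<zeta> \<bullet> x)) \<partial>\<mu>\<bar> \<le> A * S powr (- (\<delta> / 3))"
      unfolding A_def using S \<kappa> by (intro abs_cosine_moment_le_cube) auto
    also have "\<dots> \<le> A * (Q + S powr (- (\<delta> / 3)))"
      using A by (intro mult_left_mono) (auto simp: Q_def)
    finally show ?thesis using True by (simp add: S_def)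
  next
    case False
    then have "real m \<le> 2 * \<bar>real k * real m - real l * real q\<bar>" by (simp only: not_less)
    also have "\<dots> \<le> 2 * norm \<zeta>" using R(1) by (rule mult_left_mono) simp
    also have "\<dots> \<le> \<kappa> * norm \<zeta>" using \<kappa> by (intro mult_right_mono) auto
    finally have m_le: "real m \<le> \<kappa> * norm \<zeta>" .
    have "real q * real k * real l = real m * real k * (real l * (real q / real m))"
      using rk by simp
    also have "\<dots> \<le> (\<kappa> * norm \<zeta>) * (\<kappa> * norm \<zeta>) * (\<kappa> * norm \<zeta>)"
      by (rule mult_mono[OF mult_mono[OF m_le k_le] l_le]) (use \<kappa> in auto)
    finally have "\<bar>\<integral>x. cos (2 * pi * (\<zeta> \<bullet> x)) \<partial>\<mu>\<bar> \<le> A * Q"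
      unfolding A_def Q_def using Qpos \<kappa>
      by (intro abs_cosine_moment_le_cube) (auto simp: power3_eq_cube)
    then show ?thesis using False by simp
  qed
  have int: "integrable \<mu> (\<lambda>x. cos (2 * pi * (\<upsilon> \<bullet> x)))" for \<upsilon> :: "real \<times> real"
  proof (rule integrable_const_bound[where B = 1])
    have "(\<lambda>x. cos (2 * pi * (\<upsilon> \<bullet> x))) \<in> borel_measurable borel"
      by (intro borel_measurable_continuous_onI continuous_intros)
    then show "(\<lambda>x. cos (2 * pi * (\<upsilon> \<bullet> x))) \<in> borel_measurable \<mu>" by measurable
  qed (simp add: abs_cos_le_one)
  have average: "\<bar>e\<bar> \<le> b" if "e = (x + y) / 2" "a \<le> b" "\<bar>y\<bar> \<le> a" "\<bar>x\<bar> \<le> b" for e x y a b :: real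
    using that by (auto simp: abs_le_iff)
  have product: "cos (2 * pi * real k * phase m x) * cos (2 * pi * real l * phase q x)
      = (cos (2 * pi * (\<zeta> \<bullet> x)) + cos (2 * pi * (\<xi> \<bullet> x))) / 2" for x
    unfolding cos_times_cos
    by (cases x) (simp add: \<xi>_def \<zeta>_def phase_def algebra_simps)
  have "(\<integral>x. cos (2 * pi * real k * phase m x) * cos (2 * pi * real l * phase q x) \<partial>\<mu>)
      = ((\<integral>x. cos (2 * pi * (\<zeta> \<bullet> x)) \<partial>\<mu>) + (\<integral>x. cos (2 * pi * (\<xi> \<bullet> x)) \<partial>\<mu>)) / 2"
    by (simp only: product integral_divide_zero Bochner_Integration.integral_add[OF int int])
  moreover have "A * Q \<le> A * (Q +
      of_bool (2 * \<bar>real k * real m - real l * real q\<bar> < real m) * (real l * (real q / real m)) powr (- (\<delta> / 3)))"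
    using A by (intro mult_left_mono) auto
  ultimately have "\<bar>\<integral>x. cos (2 * pi * real k * phase m x) * cos (2 * pi * real l * phase q x) \<partial>\<mu>\<bar> \<le> A * (Q +
      of_bool (2 * \<bar>real k * real m - real l * real q\<bar> < real m) * (real l * (real q / real m)) powr (- (\<delta> / 3)))"
    using plus minus average by blast
  then show ?thesis unfolding A_def Q_def \<kappa>_def .
qed

section \<open>First and second moments of the hits\<close>

lemma abs_expectation_hit_deviation_le:
  assumes p: "0 \<le> p" "p \<le> 1 / 2" and m: "m \<ge> 1"
  shows "\<bar>\<integral>x. hit_deviation p (phase m x) \<partial>\<mu>\<bar> \<le> C * zeta_sum (\<delta> / 3) * real m powr (- (\<delta> / 3))"
proof -
  define \<eta> where "\<eta> = \<delta> / 3"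
  have \<eta>: "\<eta> > 0" using \<delta>_pos by (simp add: \<eta>_def)
  have int: "integrable \<mu> (\<lambda>x. cos (2 * pi * real k * phase m x))" for k
    by (rule integrable_const_bound[where B = 1]) (simp_all add: abs_cos_le_one)
  have partial: "\<bar>\<integral>x. partial_deviation r K p (phase m x) \<partial>\<mu>\<bar> \<le> C * zeta_sum \<eta> * real m powr (- \<eta>)"
    if r: "0 \<le> r" "r < 1" for r K
  proof -
    have term_le: "\<bar>r ^ k * hit_coeff p k * (\<integral>x. cos (2 * pi * real k * phase m x) \<partial>\<mu>)\<bar>
        \<le> C * real m powr (- \<eta>) * real k powr (- 1 - \<eta>)" for k
    proof (cases "k = 0")
      case False
      then have k: "k \<ge> 1" by simp
      have "\<bar>r ^ k * hit_coeff p k * (\<integral>x. cos (2 * pi * real k * phase m x) \<partial>\<mu>)\<bar>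
          \<le> 1 * (1 / real k) * (C * (real k * real m) powr (- \<eta>))"
        unfolding abs_mult \<eta>_def
        using r k by (intro mult_mono abs_hit_coeff_le_inverse abs_single_cosine_le m) (auto simp: power_le_one)
      also have "\<dots> = C * real m powr (- \<eta>) * real k powr (- 1 - \<eta>)"
        using k by (simp add: powr_mult powr_diff powr_minus divide_simps)
      finally show ?thesis .
    qed simp
    have "(\<integral>x. partial_deviation r K p (phase m x) \<partial>\<mu>)
        = (\<Sum>k<K. r ^ k * hit_coeff p k * (\<integral>x. cos (2 * pi * real k * phase m x) \<partial>\<mu>))"
      unfolding partial_deviation_def by (simp add: Bochner_Integration.integral_sum int)
    also have "\<bar>\<dots>\<bar> \<le> (\<Sum>k<K. C * real m powr (- \<eta>) * real k powr (- 1 - \<eta>))"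
      by (intro order.trans[OF sum_abs] sum_mono term_le)
    also have "\<dots> = C * real m powr (- \<eta>) * (\<Sum>k<K. real k powr (- 1 - \<eta>))"
      by (simp only: sum_distrib_left)
    also have "\<dots> \<le> C * real m powr (- \<eta>) * zeta_sum \<eta>"
      using C_pos by (intro mult_left_mono sum_powr_le_zeta_sum \<eta>) auto
    finally show ?thesis by (simp add: mult_ac)
  qed
  show ?thesis
    using abs_expectation_prod_hit_deviation_le[of "{0}" "\<lambda>_. p" "\<lambda>_. m" "C * zeta_sum \<eta> * real m powr (- \<eta>)"]
      p partial by (simp add: \<eta>_def)
qed

text \<open>In the non-resonant part both coefficients are bounded by the inverse frequency and the double
  sum factors. In the resonant part each \<open>l\<close> meets at most one \<open>k\<close>; there the coefficient of
  \<open>k\<close> is bounded by \<open>4 p\<close>, which makes the second term proportional to the radius \<open>p\<close>.\<close>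

lemma abs_expectation_pair_hit_deviation_le:
  assumes p: "0 \<le> p" "p \<le> 1 / 2" and p': "0 \<le> p'" "p' \<le> 1 / 2"
    and c: "c > 1" and m: "m \<ge> 1" and q: "real q \<ge> c * real m"
  defines "Z \<equiv> zeta_sum (\<delta> / 3)"
  shows "\<bar>\<integral>x. hit_deviation p (phase m x) * hit_deviation p' (phase q x) \<partial>\<mu>\<bar>
    \<le> C * (2 * c / (c - 1)) powr \<delta> *
       (Z\<^sup>2 * real q powr (- (\<delta> / 3)) + 4 * p * Z * (real q / real m) powr (- (\<delta> / 3)))"
proof -
  define \<eta> where "\<eta> = \<delta> / 3"
  have \<eta>: "\<eta> > 0" using \<delta>_pos by (simp add: \<eta>_def)
  have Z: "Z \<ge> 0" "(\<Sum>k<K. real k powr (- 1 - \<eta>)) \<le> Z" for K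
    unfolding Z_def \<eta>_def[symmetric] using \<eta> zeta_sum_nonneg sum_powr_le_zeta_sum by auto
  define A where "A = C * (2 * c / (c - 1)) powr \<delta>"
  have A: "A \<ge> 0" using C_pos by (simp add: A_def)
  define I where "I k l = (\<integral>x. cos (2 * pi * real k * phase m x) * cos (2 * pi * real l * phase q x) \<partial>\<mu>)" for k l
  define near where "near k l = (of_bool (2 * \<bar>real k * real m - real l * real q\<bar> < real m) :: real)" for k l
  define D where "D = A * (Z\<^sup>2 * real q powr (- \<eta>) + 4 * p * Z * (real q / real m) powr (- \<eta>))"
  have int: "integrable \<mu> (\<lambda>x. cos (2 * pi * real k * phase m x) * cos (2 * pi * real l * phase q x))" for k l
  proof (rule integrable_const_bound[where B = 1])
    have "\<bar>cos a * cos b\<bar> \<le> 1" for a b :: real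
      unfolding abs_mult using mult_mono[OF abs_cos_le_one[of a] abs_cos_le_one[of b]] by simp
    then show "AE x in \<mu>. norm (cos (2 * pi * real k * phase m x) * cos (2 * pi * real l * phase q x)) \<le> 1" by simp
  qed simp
  have partial: "\<bar>\<integral>x. partial_deviation r K p (phase m x) * partial_deviation r K p' (phase q x) \<partial>\<mu>\<bar> \<le> D"
    if r: "0 \<le> r" "r < 1" for r K
  proof -
    have term_le: "\<bar>(r ^ k * hit_coeff p k) * (r ^ l * hit_coeff p' l) * I k l\<bar> \<le>
        A * (real q powr (- \<eta>) * (real k powr (- 1 - \<eta>) * real l powr (- 1 - \<eta>))
             + 4 * p * (real q / real m) powr (- \<eta>) * (near k l * real l powr (- 1 - \<eta>)))" for k l
    proof (cases "k = 0 \<or> l = 0")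
      case True
      then show ?thesis using A p by (auto simp: near_def)
    next
      case False
      then have kl: "k \<ge> 1" "l \<ge> 1" by auto
      define G H where "G = (real q * real k * real l) powr (- \<eta>)" and "H = near k l * (real l * (real q / real m)) powr (- \<eta>)"
      have GH: "G \<ge> 0" "H \<ge> 0" by (auto simp: G_def H_def near_def)
      have rr: "\<bar>r ^ k\<bar> \<le> 1" "\<bar>r ^ l\<bar> \<le> 1" using r by (auto simp: power_le_one)
      have b: "\<bar>r ^ l * hit_coeff p' l\<bar> \<le> 1 / real l"
        unfolding abs_mult using mult_mono[OF rr(2) abs_hit_coeff_le_inverse[OF kl(2), of p']] by simp
      have a: "\<bar>r ^ k * hit_coeff p k\<bar> \<le> 1 / real k" "\<bar>r ^ k * hit_coeff p k\<bar> \<le> 4 * p"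
        unfolding abs_mult using mult_mono[OF rr(1) abs_hit_coeff_le_inverse[OF kl(1), of p]]
          mult_mono[OF rr(1) abs_hit_coeff_le_radius[OF kl(1) p(1)]] by auto
      have "\<bar>(r ^ k * hit_coeff p k) * (r ^ l * hit_coeff p' l) * I k l\<bar>
          \<le> \<bar>r ^ k * hit_coeff p k\<bar> * (1 / real l) * (A * (G + H))"
        unfolding abs_mult[of _ "I k l"] abs_mult[of "r ^ k * hit_coeff p k"]
        using abs_cosine_pair_le[OF c m q kl] b
        by (intro mult_mono) (auto simp: I_def A_def G_def H_def near_def \<eta>_def)
      also have "\<dots> = A * (1 / real l) * (\<bar>r ^ k * hit_coeff p k\<bar> * G + \<bar>r ^ k * hit_coeff p k\<bar> * H)"
        by (simp only: distrib_left distrib_right mult_ac)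
      also have "\<dots> \<le> A * (1 / real l) * (1 / real k * G + 4 * p * H)"
        using a GH A by (intro mult_left_mono add_mono mult_right_mono) auto
      also have "\<dots> = A * (real q powr (- \<eta>) * (real k powr (- 1 - \<eta>) * real l powr (- 1 - \<eta>))
             + 4 * p * (real q / real m) powr (- \<eta>) * (near k l * real l powr (- 1 - \<eta>)))"
      proof -
        have "x powr (- 1 - \<eta>) = (1 / x) * x powr (- \<eta>)" if "x > 0" for x
          using that by (simp add: powr_diff powr_minus divide_simps)
        then have e: "real k powr (- 1 - \<eta>) = (1 / real k) * real k powr (- \<eta>)"
          "real l powr (- 1 - \<eta>) = (1 / real l) * real l powr (- \<eta>)" using kl by auto
        have g: "G = real q powr (- \<eta>) * real k powr (- \<eta>) * real l powr (- \<eta>)"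
          unfolding G_def by (simp add: powr_mult)
        have h: "H = near k l * (real l powr (- \<eta>) * (real q / real m) powr (- \<eta>))"
          unfolding H_def by (simp add: powr_mult del: times_divide_eq_right)
        show ?thesis unfolding e g h by (simp add: algebra_simps del: times_divide_eq_right times_divide_eq_left)
      qed
      finally show ?thesis .
    qed
    have "(\<integral>x. partial_deviation r K p (phase m x) * partial_deviation r K p' (phase q x) \<partial>\<mu>)
        = (\<integral>x. (\<Sum>l<K. \<Sum>k<K. (r ^ k * hit_coeff p k) * (r ^ l * hit_coeff p' l) *
              (cos (2 * pi * real k * phase m x) * cos (2 * pi * real l * phase q x))) \<partial>\<mu>)"
      unfolding partial_deviation_def sum_product
      by (subst sum.swap) (simp add: mult_ac)
    also have "\<dots> = (\<Sum>l<K. \<Sum>k<K. (r ^ k * hit_coeff p k) * (r ^ l * hit_coeff p' l) * I k l)"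
      unfolding I_def by (simp add: Bochner_Integration.integral_sum int)
    finally have expand: "(\<integral>x. partial_deviation r K p (phase m x) * partial_deviation r K p' (phase q x) \<partial>\<mu>)
        = (\<Sum>l<K. \<Sum>k<K. (r ^ k * hit_coeff p k) * (r ^ l * hit_coeff p' l) * I k l)" .
    have "\<bar>\<Sum>l<K. \<Sum>k<K. (r ^ k * hit_coeff p k) * (r ^ l * hit_coeff p' l) * I k l\<bar> \<le> (\<Sum>l<K. \<Sum>k<K. A * (real q powr (- \<eta>) * (real k powr (- 1 - \<eta>) * real l powr (- 1 - \<eta>))
             + 4 * p * (real q / real m) powr (- \<eta>) * (near k l * real l powr (- 1 - \<eta>))))"
      by (intro order.trans[OF sum_abs] sum_mono order.trans[OF sum_abs] term_le)
    also have "\<dots> = A * (real q powr (- \<eta>) * ((\<Sum>k<K. real k powr (- 1 - \<eta>)) * (\<Sum>l<K. real l powr (- 1 - \<eta>)))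
             + 4 * p * (real q / real m) powr (- \<eta>) * (\<Sum>l<K. (\<Sum>k<K. near k l) * real l powr (- 1 - \<eta>)))"
    proof -
      have "(\<Sum>k<K. real k powr (- 1 - \<eta>)) * (\<Sum>l<K. real l powr (- 1 - \<eta>))
          = (\<Sum>l<K. \<Sum>k<K. real k powr (- 1 - \<eta>) * real l powr (- 1 - \<eta>))"
        by (subst sum.swap) (simp only: sum_product)
      moreover have "(\<Sum>l<K. (\<Sum>k<K. near k l) * real l powr (- 1 - \<eta>))
          = (\<Sum>l<K. \<Sum>k<K. near k l * real l powr (- 1 - \<eta>))"
        by (simp only: sum_distrib_right)
      ultimately show ?thesis
        by (simp only: sum_distrib_left sum.distrib distrib_left)
    qed
    also have "\<dots> \<le> A * (real q powr (- \<eta>) * (Z * Z) + 4 * p * (real q / real m) powr (- \<eta>) * Z)"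
    proof -
      have "(\<Sum>l<K. (\<Sum>k<K. near k l) * real l powr (- 1 - \<eta>)) \<le> (\<Sum>l<K. 1 * real l powr (- 1 - \<eta>))"
        unfolding near_def by (intro sum_mono mult_right_mono sum_near_multiples_le_1 m) auto
      then have "(\<Sum>l<K. (\<Sum>k<K. near k l) * real l powr (- 1 - \<eta>)) \<le> Z"
        using Z(2)[of K] by simp
      then show ?thesis
        using A Z p by (intro mult_left_mono add_mono mult_mono) (auto intro: sum_nonneg)
    qed
    finally show ?thesis unfolding expand D_def power2_eq_square by (simp only: mult_ac)
  qed
  have "\<bar>\<integral>x. (\<Prod>t\<in>{0, 1::nat}. hit_deviation (if t = 0 then p else p') (phase (if t = 0 then m else q) x)) \<partial>\<mu>\<bar> \<le> D"
    by (rule abs_expectation_prod_hit_deviation_le) (use p p' partial in auto)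
  then show ?thesis by (simp add: D_def A_def \<eta>_def)
qed

end

section \<open>Counting quasi-independent events\<close>

abbreviation error_term :: "real \<Rightarrow> real" where
  "error_term x \<equiv> x powr (2 / 3) * ln (2 + x) ^ 3"

lemma error_term_pos: "x > 0 \<Longrightarrow> error_term x > 0"
  by simp

lemma error_term_nonneg: "x \<ge> 0 \<Longrightarrow> error_term x \<ge> 0"
  by simp

lemma error_term_mono:
  assumes "0 \<le> x" "x \<le> y"
  shows "error_term x \<le> error_term y"
  using assms by (intro mult_mono powr_mono2 power_mono) auto

text \<open>Finitely many \<open>N\<close> are absorbed into the constant, except where the error term vanishes;
  there the count has to vanish as well.\<close>

lemma error_bound_from_tail:
  fixes \<Psi> count :: "nat \<Rightarrow> real"
  assumes nonneg: "\<And>N. \<Psi> N \<ge> 0"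
    and zero: "\<And>N. \<Psi> N = 0 \<Longrightarrow> count N = 0"
    and tail: "\<And>N. N \<ge> N0 \<Longrightarrow> \<bar>count N - 2 * \<Psi> N\<bar> \<le> C * error_term (\<Psi> N)"
  shows "\<exists>C>0. \<forall>N. \<bar>count N - 2 * \<Psi> N\<bar> \<le> C * error_term (\<Psi> N)"
proof -
  define q where "q N = \<bar>count N - 2 * \<Psi> N\<bar> / error_term (\<Psi> N)" for N
  have q: "q N \<ge> 0" for N
    using error_term_nonneg[OF nonneg[of N]] by (simp add: q_def)
  have eq: "\<bar>count N - 2 * \<Psi> N\<bar> = q N * error_term (\<Psi> N)" for N
  proof (cases "\<Psi> N = 0")
    case False
    then show ?thesis using error_term_pos[of "\<Psi> N"] nonneg[of N] by (simp add: q_def less_le)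
  qed (simp add: zero)
  define D where "D = \<bar>C\<bar> + (\<Sum>N<N0. q N) + 1"
  have S: "(\<Sum>N<N0. q N) \<ge> 0" using q by (intro sum_nonneg)
  have "\<bar>count N - 2 * \<Psi> N\<bar> \<le> D * error_term (\<Psi> N)" for N
  proof (cases "N \<ge> N0")
    case True
    have "C \<le> D" using S by (simp add: D_def)
    then show ?thesis
      using tail[OF True] mult_right_mono[OF _ error_term_nonneg[OF nonneg[of N]], of C D] by linarith
  next
    case False
    then have "q N \<le> (\<Sum>N<N0. q N)"
      using q by (intro member_le_sum) auto
    then have "q N \<le> D" by (simp add: D_def)
    then show ?thesis
      unfolding eq using mult_right_mono[OF _ error_term_nonneg[OF nonneg[of N]], of "q N" D] by linarith
  qed
  moreover have "D > 0" using S by (simp add: D_def)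
  ultimately show ?thesis by blast
qed

text \<open>By Cauchy condensation the series reduces to \<open>\<Sum> 1/k\<^sup>2\<close>.\<close>

lemma summable_inverse_mult_ln_square:
  "summable (\<lambda>j::nat. 1 / (real j * (ln (real j + 1))\<^sup>2))"
proof -
  have "summable (\<lambda>k. (2::real) ^ k * (1 / (real (2 ^ k) * (ln (real (2 ^ k) + 1))\<^sup>2)))"
  proof (rule summable_comparison_test')
    show "summable (\<lambda>k. 1 / (ln 2)\<^sup>2 * (1 / real k ^ 2))"
      by (intro summable_mult) (use inverse_power_summable[of 2, where 'a = real] in \<open>simp add: field_simps\<close>)
    fix k :: nat assume "k \<ge> 1"
    have "ln ((2::real) ^ k) \<le> ln (2 ^ k + 1)"
      by (subst ln_le_cancel_iff) (auto simp: add_pos_pos)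
    then have "real k * ln 2 \<le> ln (2 ^ k + 1)"
      by (simp add: ln_realpow)
    then have "(real k * ln 2) ^ 2 \<le> (ln (2 ^ k + 1))\<^sup>2"
      by (intro power_mono) auto
    moreover have "(real k * ln 2) ^ 2 > 0" using \<open>k \<ge> 1\<close> by simp
    ultimately have "1 / (ln (2 ^ k + 1))\<^sup>2 \<le> 1 / (real k * ln 2) ^ 2"
      by (intro frac_le) auto
    then show "norm (2 ^ k * (1 / (real (2 ^ k) * (ln (real (2 ^ k) + 1))\<^sup>2))) \<le> 1 / (ln 2)\<^sup>2 * (1 / real k ^ 2)"
      by (simp add: power_mult_distrib mult.commute)
  qed
  moreover have "1 / (real (Suc m) * (ln (real (Suc m) + 1))\<^sup>2) \<le> 1 / (real m * (ln (real m + 1))\<^sup>2)"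
    if "0 < m" for m :: nat
    using that by (intro divide_left_mono mult_mono power_mono) auto
  ultimately show ?thesis
    by (subst condensation_test) auto
qed

text \<open>The moment bounds that replace independence. The correlation of two events must
  be small relative to the radius of the earlier one, up to a term that is summable over all pairs;
  this makes the variance of the counting function linear in the total radius.\<close>

locale quasi_independent_hits = prob_space M for M :: "'a measure" +
  fixes E :: "nat \<Rightarrow> 'a set" and p :: "nat \<Rightarrow> real" and C \<rho> :: real
  assumes events [measurable]: "\<And>t. E t \<in> sets M"
    and radius: "\<And>t. t \<ge> 1 \<Longrightarrow> 0 \<le> p t \<and> p t \<le> 1 / 2"
    and const: "C \<ge> 0"
    and ratio: "0 < \<rho>" "\<rho> < 1"
    and first_moment: "\<And>t. t \<ge> 1 \<Longrightarrow> \<bar>expectation (\<lambda>x. indicator (E t) x - 2 * p t)\<bar> \<le> C * \<rho> ^ t"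
    and pair_moment: "\<And>t u. 1 \<le> t \<Longrightarrow> t < u \<Longrightarrow>
      \<bar>expectation (\<lambda>x. (indicator (E t) x - 2 * p t) * (indicator (E u) x - 2 * p u))\<bar>
        \<le> C * (p t * \<rho> ^ (u - t) + \<rho> ^ u)"
    and null: "\<And>t. t \<ge> 1 \<Longrightarrow> p t = 0 \<Longrightarrow> AE x in M. x \<notin> E t"
begin

definition X :: "nat \<Rightarrow> 'a \<Rightarrow> real" where
  "X t x = indicator (E t) x - 2 * p t"

definition total :: "nat \<Rightarrow> real" where
  "total N = (\<Sum>t=1..N. p t)"

definition hits :: "nat \<Rightarrow> 'a \<Rightarrow> real" where
  "hits N x = real (card {t \<in> {1..N}. x \<in> E t})"

lemma measurable_X [measurable]: "X t \<in> borel_measurable M"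
  unfolding X_def by measurable

lemma abs_X_le: "\<bar>X t x\<bar> \<le> 1 + 2 * \<bar>p t\<bar>"
  unfolding X_def by (cases "x \<in> E t") (auto simp: abs_le_iff)

lemma integrable_X_mult: "integrable M (\<lambda>x. X t x * X u x)"
proof (rule integrable_const_bound)
  show "AE x in M. norm (X t x * X u x) \<le> (1 + 2 * \<bar>p t\<bar>) * (1 + 2 * \<bar>p u\<bar>)"
    unfolding real_norm_def abs_mult by (intro AE_I2 mult_mono abs_X_le) auto
qed simp

lemma hits_eq: "hits N x = (\<Sum>t=1..N. indicator (E t) x)"
  unfolding hits_def by (simp add: indicator_def sum.If_cases Int_def)

lemma sum_X_eq: "(\<Sum>t=1..N. X t x) = hits N x - 2 * total N"
  unfolding X_def total_def hits_eq by (simp add: sum_subtractf sum_distrib_left)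

lemma hits_mono: "N \<le> N' \<Longrightarrow> hits N x \<le> hits N' x"
  unfolding hits_eq by (intro sum_mono2) auto

lemma total_nonneg: "total N \<ge> 0"
  unfolding total_def using radius by (intro sum_nonneg) auto

lemma total_mono: "N \<le> N' \<Longrightarrow> total N \<le> total N'"
  unfolding total_def using radius by (intro sum_mono2) auto

lemma total_Suc_le: "total (Suc N) \<le> total N + 1 / 2"
  unfolding total_def using radius[of "Suc N"] by simp

lemma prob_event_le:
  assumes "t \<ge> 1"
  shows "prob (E t) \<le> 2 * p t + C * \<rho> ^ t"
proof -
  have "expectation (\<lambda>x. indicator (E t) x - 2 * p t) = prob (E t) - 2 * p t"
    by (subst Bochner_Integration.integral_diff) (auto simp: prob_space integrable_real_indicator emeasure_eq_measure)
  then show ?thesis using first_moment[OF assms] by (simp add: abs_le_iff)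
qed

lemma expectation_X_square_le:
  assumes "t \<ge> 1"
  shows "expectation (\<lambda>x. X t x * X t x) \<le> (C + 4) * (p t + \<rho> ^ t)"
proof -
  have "expectation (\<lambda>x. X t x * X t x) = expectation (\<lambda>x. (1 - 4 * p t) * indicator (E t) x + 4 * p t * p t)"
    by (intro Bochner_Integration.integral_cong) (auto simp: X_def indicator_def algebra_simps)
  also have "\<dots> = (1 - 4 * p t) * prob (E t) + 4 * p t * p t"
    by (subst Bochner_Integration.integral_add) (auto simp: prob_space integrable_real_indicator emeasure_eq_measure)
  also have "\<dots> \<le> prob (E t) + 4 * p t * p t"
    using radius[OF assms] by (simp add: left_diff_distrib)
  also have "4 * p t * p t \<le> 2 * p t"
    using radius[OF assms] mult_left_mono[of "p t" "1/2" "4 * p t"] by simp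
  finally have "expectation (\<lambda>x. X t x * X t x) \<le> 4 * p t + C * \<rho> ^ t"
    using prob_event_le[OF assms] by simp
  also have "\<dots> \<le> (C + 4) * (p t + \<rho> ^ t)"
    using radius[OF assms] const ratio by (simp add: algebra_simps)
  finally show ?thesis .
qed

text \<open>The square is expanded into a double sum and symmetrised, with \<open>h t u\<close> bounding the moment of
  \<open>X t X u\<close> for \<open>t \<le> u\<close>. Both \<open>\<Sum>\<^sub>u p\<^sub>t \<rho>\<^sup>u\<^sup>-\<^sup>t\<close> and \<open>\<Sum>\<^sub>u \<rho>\<^sup>u\<close> over \<open>u \<ge> t\<close> are geometric.\<close>

lemma second_moment_le:
  "expectation (\<lambda>x. (hits N x - 2 * total N)\<^sup>2) \<le> 2 * (C + 4) / (1 - \<rho>)\<^sup>2 * (total N + 1)"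
proof -
  define h where "h t u = (if t \<le> u then (C + 4) * (p t * \<rho> ^ (u - t) + \<rho> ^ u) else 0)" for t u
  have pn: "p t \<ge> 0" if "t \<in> {1..N}" for t using radius that by auto
  have h_nonneg: "h t u \<ge> 0" if "t \<in> {1..N}" for t u
    using pn[OF that] const ratio by (simp add: h_def)
  have *: "expectation (\<lambda>x. X t x * X u x) \<le> h t u" if "t \<in> {1..N}" "t \<le> u" for t u
  proof (cases "t = u")
    case True
    then show ?thesis using expectation_X_square_le[of t] that by (simp add: h_def)
  next
    case False
    have "expectation (\<lambda>x. X t x * X u x) \<le> C * (p t * \<rho> ^ (u - t) + \<rho> ^ u)"
      using pair_moment[of t u] that False by (simp add: X_def abs_le_iff)
    also have "\<dots> \<le> (C + 4) * (p t * \<rho> ^ (u - t) + \<rho> ^ u)"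
      using pn[OF that(1)] ratio by (intro mult_right_mono) auto
    finally show ?thesis using that by (simp add: h_def)
  qed
  have **: "expectation (\<lambda>x. X t x * X u x) \<le> h t u + h u t" if "t \<in> {1..N}" "u \<in> {1..N}" for t u
  proof (cases "t \<le> u")
    case True
    then show ?thesis using *[OF that(1) True] h_nonneg[OF that(2), of t] by simp
  next
    case False
    then show ?thesis using *[OF that(2), of t] h_nonneg[OF that(1), of u] by (simp add: mult.commute)
  qed
  have "expectation (\<lambda>x. (hits N x - 2 * total N)\<^sup>2) = expectation (\<lambda>x. \<Sum>t=1..N. \<Sum>u=1..N. X t x * X u x)"
    by (simp only: sum_X_eq[symmetric] power2_eq_square sum_product)
  also have "\<dots> = (\<Sum>t=1..N. \<Sum>u=1..N. expectation (\<lambda>x. X t x * X u x))"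
    by (simp add: Bochner_Integration.integral_sum integrable_X_mult)
  also have "\<dots> \<le> (\<Sum>t=1..N. \<Sum>u=1..N. h t u + h u t)"
    by (intro sum_mono **)
  also have "\<dots> = 2 * (\<Sum>t=1..N. \<Sum>u=1..N. h t u)"
    using sum.swap[of h "{1..N}" "{1..N}"] by (simp add: sum.distrib)
  also have "(\<Sum>t=1..N. \<Sum>u=1..N. h t u) =
      (C + 4) * ((\<Sum>t=1..N. p t * (\<Sum>u=t..N. \<rho> ^ (u - t))) + (\<Sum>t=1..N. \<Sum>u=t..N. \<rho> ^ u))"
  proof -
    have "(\<Sum>u=1..N. h t u) = (C + 4) * (p t * (\<Sum>u=t..N. \<rho> ^ (u - t)) + (\<Sum>u=t..N. \<rho> ^ u))"
      if "t \<in> {1..N}" for t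
    proof -
      have "(\<Sum>u=1..N. h t u) = (\<Sum>u=t..N. (C + 4) * (p t * \<rho> ^ (u - t) + \<rho> ^ u))"
        using that by (intro sum.mono_neutral_cong_right) (auto simp: h_def)
      then show ?thesis by (simp only: sum_distrib_left sum.distrib distrib_left)
    qed
    then show ?thesis
      by (simp only: sum.distrib[symmetric] sum_distrib_left[of "C + 4"] cong: sum.cong)
  qed
  finally have expand: "expectation (\<lambda>x. (hits N x - 2 * total N)\<^sup>2) \<le> 2 * ((C + 4) *
      ((\<Sum>t=1..N. p t * (\<Sum>u=t..N. \<rho> ^ (u - t))) + (\<Sum>t=1..N. \<Sum>u=t..N. \<rho> ^ u)))" .
  have "(\<Sum>t=1..N. p t * (\<Sum>u=t..N. \<rho> ^ (u - t))) \<le> (\<Sum>t=1..N. p t * (1 / (1 - \<rho>)))"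
    using ratio by (intro sum_mono mult_left_mono sum_geometric_le pn) (auto simp: inj_on_def)
  also have "\<dots> = total N * (1 / (1 - \<rho>))"
    by (simp only: total_def sum_distrib_right)
  also have "\<dots> \<le> total N * (1 / (1 - \<rho>)\<^sup>2)"
    using ratio power_decreasing[of 1 2 "1 - \<rho>"] total_nonneg
    by (intro mult_left_mono frac_le) auto
  finally have first: "(\<Sum>t=1..N. p t * (\<Sum>u=t..N. \<rho> ^ (u - t))) \<le> total N * (1 / (1 - \<rho>)\<^sup>2)" .
  have "(\<Sum>t=1..N. \<Sum>u=t..N. \<rho> ^ u) = (\<Sum>t=1..N. \<rho> ^ t * (\<Sum>u=t..N. \<rho> ^ (u - t)))"
    unfolding sum_distrib_left by (intro sum.cong refl) (simp add: power_add[symmetric])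
  also have "\<dots> \<le> (\<Sum>t=1..N. \<rho> ^ t * (1 / (1 - \<rho>)))"
    using ratio by (intro sum_mono mult_left_mono sum_geometric_le) (auto simp: inj_on_def)
  also have "\<dots> = (\<Sum>t=1..N. \<rho> ^ t) * (1 / (1 - \<rho>))"
    by (simp only: sum_distrib_right)
  also have "\<dots> \<le> 1 / (1 - \<rho>) * (1 / (1 - \<rho>))"
    using ratio by (intro mult_right_mono sum_geometric_le[where f = "\<lambda>i. i"]) auto
  finally have second: "(\<Sum>t=1..N. \<Sum>u=t..N. \<rho> ^ u) \<le> 1 / (1 - \<rho>)\<^sup>2"
    by (simp add: power2_eq_square)
  note expand
  also have "2 * ((C + 4) * ((\<Sum>t=1..N. p t * (\<Sum>u=t..N. \<rho> ^ (u - t))) + (\<Sum>t=1..N. \<Sum>u=t..N. \<rho> ^ u)))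
      \<le> 2 * ((C + 4) * (total N * (1 / (1 - \<rho>)\<^sup>2) + 1 / (1 - \<rho>)\<^sup>2))"
    using const by (intro mult_left_mono add_mono first second) auto
  also have "\<dots> = 2 * (C + 4) / (1 - \<rho>)\<^sup>2 * (total N + 1)"
    using ratio by (simp add: field_simps)
  finally show ?thesis .
qed

lemma AE_null_hits: "AE x in M. \<forall>N. total N = 0 \<longrightarrow> hits N x = 0"
proof -
  have "AE x in M. \<forall>t. t \<ge> 1 \<and> p t = 0 \<longrightarrow> x \<notin> E t"
    unfolding AE_all_countable using null by (auto intro: AE_mp)
  then show ?thesis
  proof eventually_elim
    case (elim x)
    show ?case
    proof (intro allI impI)
      fix N assume "total N = 0"
      then have "\<forall>t\<in>{1..N}. p t = 0"
        unfolding total_def using radius by (subst (asm) sum_nonneg_eq_0_iff) auto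
      then show "hits N x = 0" unfolding hits_def using elim by auto
    qed
  qed
qed

text \<open>The probabilities of the events are summable, so almost surely only finitely many occur, and once
  the total radius is positive its error term is bounded below.\<close>

lemma AE_error_bound_if_bounded:
  assumes bdd: "\<And>N. total N \<le> B"
  shows "AE x in M. \<exists>N0 K. \<forall>N\<ge>N0. \<bar>hits N x - 2 * total N\<bar> \<le> K * error_term (total N)"
proof -
  have "summable (\<lambda>t. p (Suc t))"
  proof (rule summableI_nonneg_bounded)
    show "(\<Sum>i<n. p (Suc i)) \<le> B" for n
      using bdd[of n] by (simp add: total_def sum.atLeast1_atMost_eq)
  qed (use radius in auto)
  moreover have "summable (\<lambda>t. \<rho> ^ Suc t)"
    using ratio by (simp add: summable_geometric)
  ultimately have "summable (\<lambda>t. 2 * p (Suc t) + C * \<rho> ^ Suc t)"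
    by (intro summable_add summable_mult)
  then have "summable (\<lambda>t. prob (E (Suc t)))"
    by (rule summable_comparison_test'[where N = 0]) (use prob_event_le[of "Suc _"] in auto)
  then have "AE x in M. eventually (\<lambda>t. x \<in> space M - E (Suc t)) sequentially"
    by (intro borel_cantelli_AE1) (auto simp: emeasure_eq_measure)
  with AE_null_hits show ?thesis
  proof eventually_elim
    case (elim x)
    from elim(2) obtain T where T: "\<And>t. t \<ge> T \<Longrightarrow> x \<notin> E (Suc t)"
      by (auto simp: eventually_sequentially)
    have hits_le: "hits N x \<le> real T" for N
    proof -
      have "{t \<in> {1..N}. x \<in> E t} \<subseteq> {1..T}"
      proof
        fix t assume "t \<in> {t \<in> {1..N}. x \<in> E t}"
        moreover from this have "\<not> T \<le> t - 1" using T[of "t - 1"] by (cases t) auto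
        ultimately show "t \<in> {1..T}" by auto
      qed
      from card_mono[OF _ this] show ?thesis by (simp add: hits_def)
    qed
    show ?case
    proof (cases "\<forall>N. total N = 0")
      case True
      then show ?thesis using elim(1) by auto
    next
      case False
      then obtain N0 where N0: "total N0 > 0" using total_nonneg by (metis less_le)
      define e where "e = error_term (total N0)"
      have pos: "e > 0" unfolding e_def by (rule error_term_pos[OF N0])
      show ?thesis
      proof (intro exI allI impI)
        fix N assume "N \<ge> N0"
        have "\<bar>hits N x - 2 * total N\<bar> \<le> real T + 2 * B"
          using hits_le[of N] bdd[of N] total_nonneg[of N] by (auto simp: hits_def abs_le_iff)
        also have "\<dots> = (real T + 2 * B) / e * e"
          using pos by simp
        also have "\<dots> \<le> (real T + 2 * B) / e * error_term (total N)"
          unfolding e_def using pos[unfolded e_def] bdd[of 0] total_nonneg[of 0]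
          by (intro mult_left_mono error_term_mono total_mono total_nonneg \<open>N \<ge> N0\<close> divide_nonneg_pos) auto
        finally show "\<bar>hits N x - 2 * total N\<bar> \<le> (real T + 2 * B) / e * error_term (total N)" .
      qed
    qed
  qed
qed

text \<open>The exponent \<open>2/3\<close> balances two errors along the subsequence where the total radius reaches \<open>j\<^sup>3\<close>: the
  variance is of order \<open>j\<^sup>3\<close>, so deviations of size \<open>j\<^sup>2\<close> up to logarithms are barely excluded by
  Borel--Cantelli, and \<open>j\<^sup>2\<close> is also the order of the gap to \<open>(j + 1)\<^sup>3\<close>.\<close>

lemma AE_error_bound_if_unbounded:
  assumes unbdd: "\<And>B. \<exists>N. total N > B"
  shows "AE x in M. \<exists>N0 K. \<forall>N\<ge>N0. \<bar>hits N x - 2 * total N\<bar> \<le> K * error_term (total N)"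
proof -
  define T where "T j = (LEAST N. total N \<ge> real j ^ 3)" for j
  define L where "L j = ln (real j + 1)" for j :: nat
  have T_ge: "total (T j) \<ge> real j ^ 3" for j
    unfolding T_def by (rule LeastI_ex) (meson unbdd less_imp_le)
  have T_le: "total (T j) \<le> real j ^ 3 + 1" for j
  proof (cases "T j")
    case 0
    then show ?thesis by (simp add: total_def)
  next
    case (Suc N)
    then have "\<not> total N \<ge> real j ^ 3"
      unfolding T_def by (intro not_less_Least) simp
    then show ?thesis using Suc total_Suc_le[of N] by simp
  qed
  define A where "A = 2 * (C + 4) / (1 - \<rho>)\<^sup>2"
  have A: "A \<ge> 0" using const by (simp add: A_def)
  have meas [measurable]: "(\<lambda>x. hits N x - 2 * total N) \<in> borel_measurable M" for N
    unfolding sum_X_eq[symmetric] by measurable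
  have chebyshev: "prob {x \<in> space M. \<bar>hits (T j) x - 2 * total (T j)\<bar> \<ge> real j ^ 2 * L j}
      \<le> 3 * A * (1 / (real j * (L j)\<^sup>2))" if "j \<ge> 1" for j
  proof -
    have pos: "real j ^ 2 * L j > 0" using that by (simp add: L_def)
    have int: "integrable M (\<lambda>x. (hits (T j) x - 2 * total (T j))\<^sup>2)"
      unfolding sum_X_eq[symmetric] power2_eq_square sum_product
      by (intro Bochner_Integration.integrable_sum integrable_X_mult)
    have "prob {x \<in> space M. \<bar>hits (T j) x - 2 * total (T j)\<bar> \<ge> real j ^ 2 * L j}
        \<le> expectation (\<lambda>x. (hits (T j) x - 2 * total (T j))\<^sup>2) / (real j ^ 2 * L j)\<^sup>2"
      by (rule second_moment_method[OF meas int pos])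
    also have "\<dots> \<le> 3 * A * real j ^ 3 / (real j ^ 2 * L j)\<^sup>2"
    proof (rule divide_right_mono)
      have "1 \<le> real j ^ 3" using that by (intro one_le_power) simp
      then have "total (T j) + 1 \<le> 3 * real j ^ 3"
        using T_le[of j] by simp
      then have "A * (total (T j) + 1) \<le> 3 * A * real j ^ 3"
        using mult_left_mono[OF _ A] by fastforce
      then show "expectation (\<lambda>x. (hits (T j) x - 2 * total (T j))\<^sup>2) \<le> 3 * A * real j ^ 3"
        using second_moment_le[of "T j"] unfolding A_def by linarith
    qed simp
    also have "\<dots> = 3 * A * (1 / (real j * (L j)\<^sup>2))"
      using that by (simp add: power_mult_distrib divide_simps) (simp add: eval_nat_numeral)
    finally show ?thesis .
  qed
  have "summable (\<lambda>j. 3 * A * (1 / (real j * (L j)\<^sup>2)))"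
    unfolding L_def by (intro summable_mult summable_inverse_mult_ln_square)
  then have "summable (\<lambda>j. prob {x \<in> space M. \<bar>hits (T j) x - 2 * total (T j)\<bar> \<ge> real j ^ 2 * L j})"
    by (rule summable_comparison_test'[where N = 1]) (use chebyshev in auto)
  then have "AE x in M. eventually (\<lambda>j. x \<in> space M - {x \<in> space M. \<bar>hits (T j) x - 2 * total (T j)\<bar> \<ge> real j ^ 2 * L j}) sequentially"
    by (intro borel_cantelli_AE1) (auto simp: emeasure_eq_measure)
  then show ?thesis
  proof eventually_elim
    case (elim x)
    then obtain J where J: "\<And>j. j \<ge> J \<Longrightarrow> \<bar>hits (T j) x - 2 * total (T j)\<bar> < real j ^ 2 * L j"
      by (force simp: eventually_sequentially)
    have "\<bar>hits N x - 2 * total N\<bar> \<le> 20 * error_term (total N)" if N: "N \<ge> T (Suc J)" for N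
    proof -
      define P where "P = total N"
      \<comment> \<open>\<open>j\<close> is the integer with \<open>j\<^sup>3 \<le> P < (j + 1)\<^sup>3\<close>, so that \<open>T j \<le> N \<le> T (j + 1)\<close>.\<close>
      define j where "j = nat \<lfloor>P powr (1 / 3)\<rfloor>"
      have P0: "P \<ge> real (Suc J) ^ 3"
        using total_mono[OF N] T_ge[of "Suc J"] by (simp add: P_def)
      have Ppos: "P > 0" using P0 by (rule less_le_trans[rotated]) simp
      have cube: "(P powr (1 / 3)) ^ 3 = P"
        using Ppos by (simp add: powr_power)
      have j1: "real j \<le> P powr (1 / 3)" "P powr (1 / 3) < real j + 1"
        by (simp_all add: j_def)
      have jP: "real j ^ 3 \<le> P" using power_mono[OF j1(1), of 3] cube by simp
      have Pj: "P < real (Suc j) ^ 3"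
        using power_strict_mono[OF j1(2), of 3] cube by (simp add: add.commute)
      have "real (Suc J) ^ 3 < real (Suc j) ^ 3" using P0 Pj by linarith
      then have "J < j"
        using power_less_imp_less_base[of "real (Suc J)" 3 "real (Suc j)"] by simp
      then have j: "j \<ge> 1" "j \<ge> J" by auto
      have lower: "T j \<le> N" unfolding T_def by (rule Least_le) (use jP P_def in simp)
      have upper: "N \<le> T (Suc j)"
        using total_mono[of "T (Suc j)" N] T_ge[of "Suc j"] Pj unfolding P_def by linarith
      define l where "l = ln (2 + P)"
      have "real j \<le> real j ^ 3" using j self_le_power[of "real j" 3] by simp
      also note jP
      finally have "real j \<le> P" .
      then have L: "L j \<le> l" "L (Suc j) \<le> l"
        using Ppos by (auto simp: L_def l_def)
      have "1 \<le> real (Suc J) ^ 3" by (intro one_le_power) simp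
      then have "P \<ge> 1" using P0 by linarith
      then have "l \<ge> ln 3" by (simp add: l_def)
      moreover have "ln 3 \<ge> (1::real)" using exp_le by (simp add: ln_ge_iff)
      ultimately have l: "l \<ge> 1" by linarith
      have jj: "real j \<le> real j ^ 2" "1 \<le> real j ^ 2" "real j \<ge> 1"
        using j self_le_power[of "real j" 2] one_le_power[of "real j" 2] by auto
      have arith: "h \<le> 2 * (c + 1) + b" if "h - 2 * s < a" "s \<le> c + 1" "a \<le> b" for h s a b c :: real
        using that by simp
      have cube_Suc: "real (Suc j) ^ 3 = real j ^ 3 + 3 * real j ^ 2 + 3 * real j + 1"
        by (simp add: power3_eq_cube power2_eq_square algebra_simps)
      have poly_le: "2 * (a + 3 * b + 3 * d + 1 + 1) \<le> 2 * a + 16 * b" if "d \<le> b" "1 \<le> b" for a b d :: real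
        using that by simp
      have "hits N x \<le> hits (T (Suc j)) x" by (rule hits_mono[OF upper])
      also have "\<dots> \<le> 2 * (real (Suc j) ^ 3 + 1) + real (Suc j) ^ 2 * l"
        by (rule arith[OF le_less_trans[OF abs_ge_self J[OF le_SucI[OF j(2)]]] T_le
              mult_left_mono[OF L(2) zero_le_power2]])
      also have "real (Suc j) ^ 2 * l \<le> (4 * real j ^ 2) * l"
        using l jj power_mono[of "real (Suc j)" "2 * real j" 2]
        by (intro mult_right_mono) (auto simp: power_mult_distrib)
      also have "2 * (real (Suc j) ^ 3 + 1) \<le> 2 * real j ^ 3 + 16 * real j ^ 2"
        unfolding cube_Suc by (rule poly_le[OF jj(1,2)])
      finally have up: "hits N x - 2 * P \<le> 16 * real j ^ 2 + 4 * real j ^ 2 * l"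
        using jP by simp
      have "hits N x \<ge> hits (T j) x" by (rule hits_mono[OF lower])
      moreover have "hits (T j) x \<ge> 2 * real j ^ 3 - real j ^ 2 * l"
        using J[OF j(2)] T_ge[of j] mult_left_mono[OF L(1), of "real j ^ 2"] by (simp add: abs_less_iff)
      moreover have "2 * P \<le> 2 * real j ^ 3 + 16 * real j ^ 2"
        using Pj poly_le[OF jj(1,2), of "real j ^ 3"] unfolding cube_Suc by simp
      moreover have "real j ^ 2 * l \<ge> 0" using l by simp
      ultimately have "\<bar>hits N x - 2 * P\<bar> \<le> 16 * real j ^ 2 + 4 * real j ^ 2 * l"
        using up by (simp add: abs_le_iff)
      also have "\<dots> \<le> 20 * (real j ^ 2 * l)"
        using mult_left_mono[OF l, of "16 * real j ^ 2"] by (simp add: mult_ac)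
      also have "\<dots> \<le> 20 * (P powr (2 / 3) * l ^ 3)"
      proof -
        have "real j ^ 2 \<le> (P powr (1 / 3)) ^ 2" by (intro power_mono j1) simp
        also have "\<dots> = P powr (2 / 3)" using Ppos by (simp add: powr_power)
        finally show ?thesis using l self_le_power[of l 3] by (intro mult_left_mono mult_mono) auto
      qed
      finally show ?thesis by (simp add: P_def l_def)
    qed
    then show ?case by blast
  qed
qed

lemma AE_error_bound:
  "AE x in M. \<exists>K>0. \<forall>N. \<bar>hits N x - 2 * total N\<bar> \<le> K * error_term (total N)"
proof -
  have "AE x in M. \<exists>N0 K. \<forall>N\<ge>N0. \<bar>hits N x - 2 * total N\<bar> \<le> K * error_term (total N)"
  proof (cases "\<exists>B. \<forall>N. total N \<le> B")
    case True
    then show ?thesis using AE_error_bound_if_bounded by blast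
  next
    case False
    then show ?thesis by (intro AE_error_bound_if_unbounded) (meson not_le)
  qed
  with AE_null_hits show ?thesis
  proof eventually_elim
    case (elim x)
    then obtain N0 K where "\<And>N. N \<ge> N0 \<Longrightarrow> \<bar>hits N x - 2 * total N\<bar> \<le> K * error_term (total N)" by blast
    then show ?case using elim(1) total_nonneg by (intro error_bound_from_tail) auto
  qed
qed

end

section \<open>Almost every point is regular\<close>

context decaying_measure
begin

text \<open>Lacunarity turns the power bounds of the moments into geometric ones: with \<open>\<rho> = c^(-\<delta>/3)\<close>,
  the quantity \<open>n\<^sub>t^(-\<delta>/3)\<close> is at most \<open>\<rho>\<^sup>t\<^sup>-\<^sup>1\<close> and \<open>(n\<^sub>u/n\<^sub>t)^(-\<delta>/3)\<close> at most \<open>\<rho>\<^sup>u\<^sup>-\<^sup>t\<close>.\<close>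

lemma AE_regular_set:
  fixes n :: "nat \<Rightarrow> nat" and \<psi> :: "nat \<Rightarrow> real"
  assumes n_pos: "\<And>t. t \<ge> 1 \<Longrightarrow> n t > 0"
    and lac: "lacunary n"
    and \<psi>: "\<And>t. t \<ge> 1 \<Longrightarrow> 0 \<le> \<psi> (n t) \<and> \<psi> (n t) \<le> 1 / 2"
  shows "AE x in \<mu>. x \<in> regular_set n \<psi>"
proof -
  obtain c where c: "c > 1" and step: "\<And>t. t \<ge> 1 \<Longrightarrow> real (n (Suc t)) \<ge> c * real (n t)"
    using lac by (auto simp: lacunary_def)
  have n1: "real (n t) \<ge> 1" if "t \<ge> 1" for t
    using n_pos[OF that] by simp
  have growth: "real (n (t + d)) \<ge> c ^ d * real (n t)" if "t \<ge> 1" for t d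
  proof (induction d)
    case (Suc d)
    have "c ^ Suc d * real (n t) \<le> c * real (n (t + d))"
      using mult_left_mono[OF Suc.IH, of c] c by (simp add: mult_ac)
    also have "\<dots> \<le> real (n (t + Suc d))" using step[of "t + d"] that by simp
    finally show ?case .
  qed simp
  define \<eta> where "\<eta> = \<delta> / 3"
  have \<eta>: "\<eta> > 0" using \<delta>_pos by (simp add: \<eta>_def)
  define \<rho> where "\<rho> = c powr (- \<eta>)"
  have \<rho>: "0 < \<rho>" "\<rho> < 1" using c \<eta> by (auto simp: \<rho>_def powr_less_one)
  have pow: "(c ^ d) powr (- \<eta>) = \<rho> ^ d" for d
    using c by (simp add: \<rho>_def powr_power powr_realpow[symmetric] powr_powr mult_ac)
  have ratio: "(real (n u) / real (n t)) powr (- \<eta>) \<le> \<rho> ^ (u - t)" if "1 \<le> t" "t < u" for t u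
  proof -
    have "c ^ (u - t) \<le> real (n u) / real (n t)"
      using growth[OF that(1), of "u - t"] n1[OF that(1)] that by (simp add: pos_le_divide_eq)
    then have "(real (n u) / real (n t)) powr (- \<eta>) \<le> (c ^ (u - t)) powr (- \<eta>)"
      using \<eta> c by (intro powr_mono2') auto
    then show ?thesis by (simp only: pow)
  qed
  have size: "real (n t) powr (- \<eta>) \<le> \<rho> ^ t / \<rho>" if "t \<ge> 1" for t
  proof -
    have "c ^ (t - 1) * 1 \<le> c ^ (t - 1) * real (n 1)"
      using c n1[of 1] by (intro mult_left_mono) auto
    also have "\<dots> \<le> real (n t)" using growth[of 1 "t - 1"] that by simp
    finally have "real (n t) powr (- \<eta>) \<le> (c ^ (t - 1)) powr (- \<eta>)"
      using \<eta> c by (intro powr_mono2') auto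
    also have "\<dots> = \<rho> ^ t / \<rho>" unfolding pow using \<rho> that by (simp add: power_diff)
    finally show ?thesis .
  qed
  define Z where "Z = zeta_sum \<eta>"
  have Z: "Z \<ge> 0" using zeta_sum_nonneg[OF \<eta>] by (simp add: Z_def)
  define A where "A = C * (2 * c / (c - 1)) powr \<delta>"
  have A: "A \<ge> 0" using C_pos by (simp add: A_def)
  define B where "B = C * Z / \<rho> + A * Z\<^sup>2 / \<rho> + 4 * A * Z"
  have "C * Z / \<rho> \<ge> 0" "A * Z\<^sup>2 / \<rho> \<ge> 0" "4 * A * Z \<ge> 0" using C_pos Z A \<rho> by auto
  then have B: "C * Z / \<rho> \<le> B" "A * Z\<^sup>2 / \<rho> \<le> B" "4 * A * Z \<le> B" "B \<ge> 0"
    unfolding B_def by linarith+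
  define E where "E t = {x. dist_nearest_int (phase (n t) x) \<le> \<psi> (n t)}" for t
  have dev: "indicator (E t) x - 2 * \<psi> (n t) = hit_deviation (\<psi> (n t)) (phase (n t) x)" for t x
    by (simp add: E_def hit_deviation_def indicator_def)
  interpret quasi_independent_hits \<mu> E "\<lambda>t. \<psi> (n t)" B \<rho>
  proof
    show "E t \<in> sets \<mu>" for t
    proof -
      have "{x \<in> space borel. dist_nearest_int (phase (n t) x) \<le> \<psi> (n t)} \<in> sets borel"
        by measurable
      then show ?thesis by (simp add: E_def sets_eq)
    qed
    show "0 \<le> \<psi> (n t) \<and> \<psi> (n t) \<le> 1 / 2" if "t \<ge> 1" for t by (rule \<psi>[OF that])
    show "B \<ge> 0" "0 < \<rho>" "\<rho> < 1" by fact+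
    show "\<bar>expectation (\<lambda>x. indicator (E t) x - 2 * \<psi> (n t))\<bar> \<le> B * \<rho> ^ t" if "t \<ge> 1" for t
    proof -
      have "\<bar>expectation (\<lambda>x. indicator (E t) x - 2 * \<psi> (n t))\<bar> \<le> C * Z * real (n t) powr (- \<eta>)"
        unfolding dev Z_def \<eta>_def using \<psi>[OF that] n_pos[OF that]
        by (intro abs_expectation_hit_deviation_le) auto
      also have "\<dots> \<le> C * Z * (\<rho> ^ t / \<rho>)"
        using size[OF that] C_pos Z by (intro mult_left_mono) auto
      also have "\<dots> = (C * Z / \<rho>) * \<rho> ^ t" by simp
      also have "\<dots> \<le> B * \<rho> ^ t" using B \<rho> by (intro mult_right_mono) auto
      finally show ?thesis .
    qed
    show "\<bar>expectation (\<lambda>x. (indicator (E t) x - 2 * \<psi> (n t)) * (indicator (E u) x - 2 * \<psi> (n u)))\<bar>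
        \<le> B * (\<psi> (n t) * \<rho> ^ (u - t) + \<rho> ^ u)" if tu: "1 \<le> t" "t < u" for t u
    proof -
      have u: "1 \<le> u" using tu by simp
      have "c * real (n t) \<le> c ^ (u - t) * real (n t)"
        using power_increasing[of 1 "u - t" c] c tu by (intro mult_right_mono) auto
      also have "\<dots> \<le> real (n u)" using growth[OF tu(1), of "u - t"] tu by simp
      finally have q: "real (n u) \<ge> c * real (n t)" .
      have "\<bar>expectation (\<lambda>x. (indicator (E t) x - 2 * \<psi> (n t)) * (indicator (E u) x - 2 * \<psi> (n u)))\<bar>
          \<le> A * (Z\<^sup>2 * real (n u) powr (- \<eta>) + 4 * \<psi> (n t) * Z * (real (n u) / real (n t)) powr (- \<eta>))"
        unfolding dev A_def Z_def \<eta>_def using \<psi>[OF tu(1)] \<psi>[OF u] n_pos[OF tu(1)] c q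
        by (intro abs_expectation_pair_hit_deviation_le) auto
      also have "\<dots> \<le> A * (Z\<^sup>2 * (\<rho> ^ u / \<rho>) + 4 * \<psi> (n t) * Z * \<rho> ^ (u - t))"
        using A Z \<psi>[OF tu(1)] by (intro mult_left_mono add_mono size[OF u] ratio[OF tu]) auto
      also have "\<dots> = (A * Z\<^sup>2 / \<rho>) * \<rho> ^ u + (4 * A * Z) * (\<psi> (n t) * \<rho> ^ (u - t))"
        by (simp add: algebra_simps)
      also have "\<dots> \<le> B * \<rho> ^ u + B * (\<psi> (n t) * \<rho> ^ (u - t))"
        using B \<rho> \<psi>[OF tu(1)] by (intro add_mono mult_right_mono) auto
      finally show ?thesis by (simp add: algebra_simps)
    qed
    show "AE x in \<mu>. x \<notin> E t" if "t \<ge> 1" "\<psi> (n t) = 0" for t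
      using AE_phase_minus_not_int[of "n t" 0]
    proof eventually_elim
      case (elim x)
      show ?case
      proof
        assume "x \<in> E t"
        then have "phase (n t) x = of_int (round (phase (n t) x))"
          using that by (simp add: E_def dist_nearest_int_def)
        then show False using elim by (metis Ints_of_int diff_zero)
      qed
    qed
  qed
  have "real (hit_count n \<psi> (fst x) (snd x) N) = hits N x" "psi_sum n \<psi> N = total N" for x N
    by (simp_all add: hit_count_def hits_def E_def phase_def psi_sum_def total_def)
  then show ?thesis
    using AE_error_bound by (simp add: regular_set_def case_prod_beta)
qed

end

theorem corollary1p16:
  fixes n :: "nat \<Rightarrow> nat" and \<psi> :: "nat \<Rightarrow> real"
  assumes "\<And>t. t \<ge> 1 \<Longrightarrow> n t > 0"
    and "lacunary n"
    and "\<And>k. k \<ge> 1 \<Longrightarrow> \<psi> k \<in> {0..1}"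
    and "\<And>t. t \<ge> 1 \<Longrightarrow> \<psi> (n t) \<le> 1/2"
  shows "fourier_dim (({0..1} \<times> {0..1}) - regular_set n \<psi>) = 0"
proof -
  have "s \<le> 0" if \<mu>: "\<mu> \<in> compactly_supported_probs (({0..1} \<times> {0..1}) - regular_set n \<psi>)"
    and "fourier_decay \<mu> s" for \<mu> s
  proof (rule ccontr)
    assume "\<not> s \<le> 0"
    obtain K where K: "compact K" "K \<subseteq> ({0..1} \<times> {0..1}) - regular_set n \<psi>" "emeasure \<mu> (- K) = 0"
      and sets: "sets \<mu> = sets borel" and prob: "prob_space \<mu>"
      using \<mu> by (auto simp: compactly_supported_probs_def)
    obtain C where C: "C > 0" "\<And>\<xi>. norm (fourier_transform \<mu> \<xi>) \<le> C * (1 + norm \<xi>) powr (- (s / 2))"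
      using \<open>fourier_decay \<mu> s\<close> by (auto simp: fourier_decay_def)
    interpret decaying_measure \<mu> C "s / 2"
      using prob sets C \<open>\<not> s \<le> 0\<close> by (intro decaying_measure.intro decaying_measure_axioms.intro) auto
    have "AE x in \<mu>. x \<in> regular_set n \<psi>"
      by (rule AE_regular_set) (use assms(1,2,4) assms(3)[of "n _"] in \<open>auto simp: Suc_le_eq\<close>)
    moreover have "AE x in \<mu>. x \<in> K"
      by (rule AE_I[of _ _ "- K"]) (use K sets in \<open>auto simp: compact_imp_closed\<close>)
    ultimately have "AE x in \<mu>. False"
      by eventually_elim (use K in blast)
    then show False by simp
  qed
  then show ?thesis
    unfolding fourier_dim_def by (intro cSup_eq_maximum) auto
qed

end
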